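(* Let $u=(u_1,\ldots,u_d)$ be a $d$-tuple of free Haar unitaries. Define $$E:=\Big\{x\in\mathbb R^d:\inf_{t>0}\Big|\sum_{i=1}^d\sqrt{t^2+x_i^2}-(d-1)t\Big|\le1\Big\}$$ and $$Q=\{z\in\mathbb C^d:(|z_1|,\ldots,|z_d|)\in E\}.$$ Then the numerical range $\mathcal W_1(u)$ is given by the polar dual of $Q$, $$\mathcal W_1(u)=Q'=\Big\{w\in\mathbb C^d:\mathrm{Re}\sum_{i=1}^dw_iz_i\le1\text{ for all }z\in Q\Big\}.$$ In particular, $0\in\mathrm{int}\,\mathcal W_1(u)$.
   Context: A $d$-tuple of free Haar unitaries is a tuple $u=(u_1,\ldots,u_d)$ of unitaries in a C*-probability space $(\mathcal A,\tau,\|\cdot\|)$ (in the usual sense of free probability: $\mathcal A$ is a unital C*-algebra with norm $\|\cdot\|$ and $\tau$ is its distinguished state) which are freely independent (whenever each $x_k$ lies in the unital $*$-algebra generated by $u_{i_k}$, $i_k\ne i_{k+1}$ and $\tau(x_k)=0$ for all $k$, then $\tau(x_1\cdots x_n)=0$) and satisfy $\tau(u_i^k)=0$ for all $i$ and all $k\in\mathbb Z\setminus\{0\}$. The numerical range of a $d$-tuple $A=(A_1,\ldots,A_d)$ in a unital C*-algebra $\mathcal A$ is the first level of its matrix range, $\mathcal W_1(A)=\{(\phi(A_1),\ldots,\phi(A_d)):\phi\text{ a state on }\mathcal A\}\subseteq\mathbb C^d$. The interior is taken in $\mathbb C^d$.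
   Formalization: The distinguished state τ is assumed to be faithful; without this the claim fails for d ≥ 2, e.g. for the universal unitaries in the full group C*-algebra of the free group with its canonical trace. *)

theory Defs
  imports "HOL-Analysis.Analysis"
begin

text \<open>
  Unital C*-algebras. The complex scalar multiplication extends the real one of the
  underlying Banach algebra, which also supplies \<open>1 *\<^sub>C a = a\<close>. The class
  \<^class>\<open>real_normed_algebra_1\<close> requires \<open>norm 1 = 1\<close>, which for a C*-algebra says exactly
  that it is not the zero algebra.
\<close>
class cstar_algebra = real_normed_algebra_1 + banach +
  fixes scaleC :: "complex \<Rightarrow> 'a \<Rightarrow> 'a" (infixr "*\<^sub>C" 75)
    and star :: "'a \<Rightarrow> 'a" ("(_\<^sup>\<star>)" [1000] 999)
  assumes scaleC_add_right: "c *\<^sub>C (a + b) = c *\<^sub>C a + c *\<^sub>C b"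
    and scaleC_add_left: "(c + c') *\<^sub>C a = c *\<^sub>C a + c' *\<^sub>C a"
    and scaleC_scaleC: "c *\<^sub>C (c' *\<^sub>C a) = (c * c') *\<^sub>C a"
    and scaleC_of_real: "complex_of_real r *\<^sub>C a = r *\<^sub>R a"
    and mult_scaleC_left: "(c *\<^sub>C a) * b = c *\<^sub>C (a * b)"
    and mult_scaleC_right: "a * (c *\<^sub>C b) = c *\<^sub>C (a * b)"
    and norm_scaleC: "norm (c *\<^sub>C a) = cmod c * norm a"
    and star_add: "(a + b)\<^sup>\<star> = a\<^sup>\<star> + b\<^sup>\<star>"
    and star_scaleC: "(c *\<^sub>C a)\<^sup>\<star> = cnj c *\<^sub>C a\<^sup>\<star>"
    and star_mult: "(a * b)\<^sup>\<star> = b\<^sup>\<star> * a\<^sup>\<star>"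
    and star_star: "(a\<^sup>\<star>)\<^sup>\<star> = a"
    and cstar_identity: "norm (a\<^sup>\<star> * a) = (norm a)\<^sup>2"

definition state :: "('a::cstar_algebra \<Rightarrow> complex) \<Rightarrow> bool" where
  "state \<phi> \<longleftrightarrow>
     (\<forall>a b. \<phi> (a + b) = \<phi> a + \<phi> b) \<and>
     (\<forall>c a. \<phi> (c *\<^sub>C a) = c * \<phi> a) \<and>
     (\<forall>a. \<phi> (a\<^sup>\<star> * a) \<in> \<real>\<^sub>\<ge>\<^sub>0) \<and>
     \<phi> 1 = 1"

text \<open>
  As usual when the norm is part of the data of a C*-probability space, the distinguished
  state is faithful. This is what ties the norm to the state: with a non-faithful state, the
  universal unitaries in the full group C*-algebra of the free group would also be free
  Haar unitaries with respect to the canonical trace, although their norms and numerical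
  range differ from those in the reduced one.
\<close>
definition cstar_probability_space :: "('a::cstar_algebra \<Rightarrow> complex) \<Rightarrow> bool" where
  "cstar_probability_space \<tau> \<longleftrightarrow> state \<tau> \<and> (\<forall>a. \<tau> (a\<^sup>\<star> * a) = 0 \<longrightarrow> a = 0)"

definition star_subalgebra :: "'a::cstar_algebra set \<Rightarrow> bool" where
  "star_subalgebra B \<longleftrightarrow>
     1 \<in> B \<and>
     (\<forall>a\<in>B. \<forall>b\<in>B. a + b \<in> B \<and> a * b \<in> B) \<and>
     (\<forall>c. \<forall>a\<in>B. c *\<^sub>C a \<in> B) \<and>
     (\<forall>a\<in>B. a\<^sup>\<star> \<in> B)"

definition unitary :: "'a::cstar_algebra \<Rightarrow> bool" where
  "unitary v \<longleftrightarrow> v\<^sup>\<star> * v = 1 \<and> v * v\<^sup>\<star> = 1"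

text \<open>Integer powers of a unitary, whose inverse is its adjoint.\<close>
definition unitary_power :: "'a::cstar_algebra \<Rightarrow> int \<Rightarrow> 'a" where
  "unitary_power v k = (if k \<ge> 0 then v ^ nat k else (v\<^sup>\<star>) ^ nat (- k))"

text \<open>
  In \<open>free_independent\<close>, the alternating word is \<open>x 0 * x 1 * \<dots> * x (n - 1)\<close>, with
  letter \<open>x k\<close> taken from the unital *-algebra generated by \<open>u $ i k\<close>.
\<close>
definition free_independent :: "('a::cstar_algebra \<Rightarrow> complex) \<Rightarrow> 'a ^ 'n \<Rightarrow> bool" where
  "free_independent \<tau> u \<longleftrightarrow>
     (\<forall>(n::nat) (i :: nat \<Rightarrow> 'n) (x :: nat \<Rightarrow> 'a).
        n \<ge> 1 \<longrightarrow>
        (\<forall>k. k + 1 < n \<longrightarrow> i k \<noteq> i (k + 1)) \<longrightarrow>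
        (\<forall>k<n. x k \<in> star_subalgebra hull {u $ i k} \<and> \<tau> (x k) = 0) \<longrightarrow>
        \<tau> (prod_list (map x [0..<n])) = 0)"

definition free_haar_unitaries :: "('a::cstar_algebra \<Rightarrow> complex) \<Rightarrow> 'a ^ 'n \<Rightarrow> bool" where
  "free_haar_unitaries \<tau> u \<longleftrightarrow>
     (\<forall>i. unitary (u $ i)) \<and>
     free_independent \<tau> u \<and>
     (\<forall>i. \<forall>k::int. k \<noteq> 0 \<longrightarrow> \<tau> (unitary_power (u $ i) k) = 0)"

definition numerical_range :: "'a::cstar_algebra ^ 'n \<Rightarrow> (complex ^ 'n) set" where
  "numerical_range A = {(\<chi> i. \<phi> (A $ i)) | \<phi>. state \<phi>}"

definition E_set :: "(real ^ 'n::finite) set" where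
  "E_set = {x. (INF t\<in>{0<..}. \<bar>(\<Sum>i\<in>UNIV. sqrt (t\<^sup>2 + (x $ i)\<^sup>2)) - (real CARD('n) - 1) * t\<bar>) \<le> 1}"

definition Q_set :: "(complex ^ 'n::finite) set" where
  "Q_set = {z. (\<chi> i. cmod (z $ i)) \<in> E_set}"

text \<open>The pairing is bilinear: there is no complex conjugation.\<close>
definition polar_dual :: "(complex ^ 'n::finite) set \<Rightarrow> (complex ^ 'n) set" where
  "polar_dual S = {w. \<forall>z\<in>S. Re (\<Sum>i\<in>UNIV. w $ i * z $ i) \<le> 1}"

end

theory Submission
  imports Defs
begin

text \<open>
  The numerical range is a compact convex set, so it is determined by its support function:
  the claim is that, in direction \<open>z\<close>, the supremum of \<open>Re (\<Sum>i. \<phi> (u i) * z i)\<close> over all states \<open>\<phi>\<close> is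
  the infimum over \<open>t > 0\<close> of \<open>level t x = (\<Sum>i. sqrt (t\<^sup>2 + x i ^ 2)) - (d - 1) * t\<close>, where \<open>x i = cmod (z i)\<close>.
  Since this infimum is homogeneous in \<open>x\<close>, the numerical range is then the polar of its unit ball,
  by separation of a point from a closed convex set.

  The supremum is computed on the Cayley tree of the free group. By freeness the reduced words in
  the \<open>u i\<close> and their adjoints are orthonormal for \<open>\<tau>\<close> (\<open>word_orthonormal\<close>), and for a finite
  combination \<open>b\<close> of them with coefficients \<open>c\<close>, the number \<open>Re (\<tau> (b* h b))\<close> with \<open>h\<close> the real part of
  \<open>\<Sum>i. z i * u i\<close> is a sum over the edges of the tree, each joining a word to the parent that
  results from deleting its first letter (\<open>combination_re_sum_form\<close>).

  Upper bound. On an edge of type \<open>i\<close> with value \<open>a\<close> at the parent and \<open>b\<close> at the child, the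
  arithmetic-geometric inequality gives \<open>2 x a b \<le> p a\<^sup>2 + (p + 2 t) b\<^sup>2\<close>, where \<open>p = sqrt (t\<^sup>2 + x\<^sup>2) - t\<close>
  solves \<open>p (p + 2 t) = x\<^sup>2\<close>. Summing over all edges, the excess \<open>2 t\<close> at the child is the same for all
  types, so that every vertex other than the root receives exactly \<open>2 * level t x\<close>, and the root
  less. Thus \<open>level t x - h\<close> is positive in every vector state given by a combination of words.
  Faithfulness of \<open>\<tau>\<close> turns this into positivity in every state of the algebra (\<open>faithful_state_detects_positivity\<close>);
  the absolute value needed there comes from the binomial series of the square root, which still
  converges on the boundary of its disc.

  Lower bound. Equality on all edges determines \<open>c\<close> as a product over letters. If \<open>t\<close> is a critical
  point of \<open>level\<close>, then this \<open>c\<close> has about the same mass on every sphere of the tree; its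
  truncations to large balls are almost eigenvectors, and their vector states
  approach the value \<open>level t x\<close> (\<open>critical_level_le_of_states\<close>).
\<close>

section \<open>Complex scalars, adjoints and norms\<close>

lemma scaleC_one [simp]: "1 *\<^sub>C a = (a::'a::cstar_algebra)"
  using scaleC_of_real[of 1 a] by simp

lemma scaleC_zero_left [simp]: "0 *\<^sub>C a = (0::'a::cstar_algebra)"
  using scaleC_of_real[of 0 a] by simp

lemma scaleC_zero_right [simp]: "c *\<^sub>C (0::'a::cstar_algebra) = 0"
  using scaleC_add_right[of c 0 0] by simp

lemma scaleC_minus_one: "(- 1) *\<^sub>C a = - (a::'a::cstar_algebra)"
  using scaleC_of_real[of "- 1" a] by simp

lemma scaleC_minus_right: "c *\<^sub>C (- a) = - (c *\<^sub>C (a::'a::cstar_algebra))"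
  by (metis scaleC_minus_one scaleC_scaleC mult.commute)

lemma scaleC_minus_left: "(- c) *\<^sub>C a = - (c *\<^sub>C (a::'a::cstar_algebra))"
  by (metis scaleC_minus_one scaleC_scaleC mult_minus1)

lemma scaleC_diff_right: "c *\<^sub>C (a - b) = c *\<^sub>C a - c *\<^sub>C (b::'a::cstar_algebra)"
  using scaleC_add_right[of c a "- b"] by (simp add: scaleC_minus_right)

lemma scaleC_sum_right: "c *\<^sub>C (\<Sum>i\<in>I. f i) = (\<Sum>i\<in>I. c *\<^sub>C (f i :: 'a::cstar_algebra))"
  by (induction I rule: infinite_finite_induct) (auto simp: scaleC_add_right)

lemma star_zero [simp]: "(0::'a::cstar_algebra)\<^sup>\<star> = 0"
  using star_add[of "0::'a" 0] by simp

lemma star_one [simp]: "(1::'a::cstar_algebra)\<^sup>\<star> = 1"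
  by (metis mult.right_neutral star_mult star_star)

lemma star_minus: "(- a)\<^sup>\<star> = - (a::'a::cstar_algebra)\<^sup>\<star>"
  by (metis star_scaleC scaleC_minus_one complex_cnj_minus complex_cnj_one)

lemma star_diff: "(a - b)\<^sup>\<star> = a\<^sup>\<star> - (b::'a::cstar_algebra)\<^sup>\<star>"
  using star_add[of a "- b"] by (simp add: star_minus)

lemma star_scaleR: "(r *\<^sub>R a)\<^sup>\<star> = r *\<^sub>R (a::'a::cstar_algebra)\<^sup>\<star>"
  by (metis star_scaleC scaleC_of_real complex_cnj_complex_of_real)

lemma star_sum: "(\<Sum>i\<in>I. f i)\<^sup>\<star> = (\<Sum>i\<in>I. (f i :: 'a::cstar_algebra)\<^sup>\<star>)"
  by (induction I rule: infinite_finite_induct) (auto simp: star_add)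

lemma star_power: "(a ^ n)\<^sup>\<star> = (a::'a::cstar_algebra)\<^sup>\<star> ^ n"
  by (induction n) (auto simp: star_mult power_commutes)

lemma norm_star [simp]: "norm (a\<^sup>\<star>) = norm (a::'a::cstar_algebra)"
proof -
  have le: "norm b \<le> norm (b\<^sup>\<star>)" for b :: 'a
  proof (cases "b = 0")
    case False
    have "norm b * norm b \<le> norm (b\<^sup>\<star>) * norm b"
      using cstar_identity[of b] norm_mult_ineq[of "b\<^sup>\<star>" b] by (simp add: power2_eq_square)
    then show ?thesis using False by simp
  qed simp
  show ?thesis using le[of a] le[of "a\<^sup>\<star>"] by (simp add: star_star)
qed

lemma bounded_linear_star: "bounded_linear (star :: 'a::cstar_algebra \<Rightarrow> 'a)"
  by (rule bounded_linear_intro[where K = 1]) (auto simp: star_add star_scaleR)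

lemma star_eq_zero_if: "a\<^sup>\<star> * a = 0 \<Longrightarrow> (a::'a::cstar_algebra) = 0"
  using cstar_identity[of a] by simp

section \<open>Square roots and the positive part\<close>

text \<open>
  These are the Taylor coefficients of \<open>sqrt (1 - y)\<close>. Since all but the first are negative and
  all partial sums are nonnegative, the series still converges absolutely on the
  boundary of the unit disc. This is what makes it possible to take square roots of
  non-invertible positive elements without any functional calculus.
\<close>
definition sqrt_coeff :: "nat \<Rightarrow> real" where
  "sqrt_coeff n = ((1/2) gchoose n) * (- 1) ^ n"

lemma sqrt_coeff_0 [simp]: "sqrt_coeff 0 = 1"
  by (simp add: sqrt_coeff_def)

lemma neg_gbinomial_sign: "(a gchoose n) * (- 1) ^ n \<ge> (0::real)" if "a < 0"
proof -
  have "(a gchoose n) * (- 1) ^ n = (- a + of_nat n - 1) gchoose n"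
    by (subst gbinomial_negated_upper) (simp add: power_mult_distrib[symmetric] mult.assoc mult.commute flip: power_add)
  also have "\<dots> = (\<Prod>i = 0..<n. (- a + of_nat n - 1) - of_nat i) / fact n"
    by (simp add: gbinomial_prod_rev)
  also have "\<dots> \<ge> 0" using that by (intro divide_nonneg_nonneg prod_nonneg) auto
  finally show ?thesis .
qed

lemma sqrt_coeff_Suc_nonpos: "sqrt_coeff (Suc n) \<le> 0"
proof -
  have "sqrt_coeff (Suc n) = - (1/2) * (((-1/2) gchoose n) * (- 1) ^ n) / real (Suc n)"
    using gbinomial_absorption'[of "Suc n" "1/2::real"]
    by (simp add: sqrt_coeff_def field_simps)
  also have "\<dots> \<le> 0" using neg_gbinomial_sign[of "-1/2" n] by (intro divide_nonpos_nonneg) auto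
  finally show ?thesis .
qed

lemma sqrt_coeff_partial_sum: "(\<Sum>k\<le>n. sqrt_coeff k) \<ge> 0"
  using gbinomial_sum_lower_neg[of "1/2::real" n] neg_gbinomial_sign[of "-1/2" n]
  by (simp add: sqrt_coeff_def mult.commute)

lemma sqrt_coeff_tail_sum: "(\<Sum>k<n. \<bar>sqrt_coeff (Suc k)\<bar>) \<le> 1"
proof -
  have "(\<Sum>k<n. \<bar>sqrt_coeff (Suc k)\<bar>) = - (\<Sum>k<n. sqrt_coeff (Suc k))"
    using sqrt_coeff_Suc_nonpos by (simp add: sum_negf[symmetric] abs_of_nonpos)
  also have "\<dots> = 1 - (\<Sum>k\<le>n. sqrt_coeff k)"
    by (simp add: sum.atMost_shift)
  finally show ?thesis using sqrt_coeff_partial_sum[of n] by simp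
qed

lemma summable_sqrt_coeff: "summable (\<lambda>n. \<bar>sqrt_coeff n\<bar>)"
proof -
  have "summable (\<lambda>n. \<bar>sqrt_coeff (Suc n)\<bar>)"
    by (rule summableI_nonneg_bounded[where x = 1]) (use sqrt_coeff_tail_sum in auto)
  then show ?thesis by (subst summable_Suc_iff[symmetric])
qed

definition sqrt_compl :: "'a::{real_normed_algebra_1,banach} \<Rightarrow> 'a" where
  "sqrt_compl y = (\<Sum>n. sqrt_coeff n *\<^sub>R y ^ n)"

lemma norm_sqrt_term_le:
  fixes y :: "'a::{real_normed_algebra_1,banach}"
  assumes "norm y \<le> 1"
  shows "norm (sqrt_coeff n *\<^sub>R y ^ n) \<le> \<bar>sqrt_coeff n\<bar>"
proof -
  have "norm (y ^ n) \<le> 1" by (rule order_trans[OF norm_power_ineq power_le_one]) (use assms in auto)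
  then show ?thesis by (simp add: mult_left_le)
qed

lemma sqrt_compl_sums:
  fixes y :: "'a::{real_normed_algebra_1,banach}"
  assumes "norm y \<le> 1"
  shows "summable (\<lambda>n. norm (sqrt_coeff n *\<^sub>R y ^ n))"
    and "(\<lambda>n. sqrt_coeff n *\<^sub>R y ^ n) sums sqrt_compl y"
proof -
  show s: "summable (\<lambda>n. norm (sqrt_coeff n *\<^sub>R y ^ n))"
    by (rule summable_comparison_test'[OF summable_sqrt_coeff, of 0])
       (use norm_sqrt_term_le[OF assms] in auto)
  show "(\<lambda>n. sqrt_coeff n *\<^sub>R y ^ n) sums sqrt_compl y"
    unfolding sqrt_compl_def using summable_sums[OF summable_norm_cancel[OF s]] .
qed

lemma sqrt_compl_square:
  fixes y :: "'a::{real_normed_algebra_1,banach}"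
  assumes "norm y \<le> 1"
  shows "sqrt_compl y * sqrt_compl y = 1 - y"
proof -
  let ?t = "\<lambda>n. sqrt_coeff n *\<^sub>R y ^ n"
  have "(\<lambda>k. \<Sum>i\<le>k. ?t i * ?t (k - i)) sums ((\<Sum>n. ?t n) * (\<Sum>n. ?t n))"
    by (intro Cauchy_product_sums sqrt_compl_sums(1) assms)
  moreover have "(\<Sum>i\<le>k. ?t i * ?t (k - i)) = ((1 gchoose k) * (- 1) ^ k) *\<^sub>R y ^ k" for k
  proof -
    have "(\<Sum>i\<le>k. ?t i * ?t (k - i)) = (\<Sum>i\<le>k. (sqrt_coeff i * sqrt_coeff (k - i)) *\<^sub>R y ^ k)"
      by (intro sum.cong) (auto simp flip: power_add)
    also have "\<dots> = (\<Sum>i\<le>k. sqrt_coeff i * sqrt_coeff (k - i)) *\<^sub>R y ^ k"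
      by (simp add: scaleR_sum_left)
    also have "(\<Sum>i\<le>k. sqrt_coeff i * sqrt_coeff (k - i))
        = (\<Sum>i\<le>k. (((1/2) gchoose i) * ((1/2) gchoose (k - i))) * (- 1) ^ k)"
      by (intro sum.cong) (auto simp: sqrt_coeff_def simp flip: power_add)
    also have "\<dots> = (1 gchoose k) * (- 1) ^ k"
      using gbinomial_Vandermonde[of "1/2::real" "1/2" k]
      by (simp flip: sum_distrib_right add: atLeast0AtMost)
    finally show ?thesis .
  qed
  ultimately have "(\<lambda>k. ((1 gchoose k) * (- 1) ^ k) *\<^sub>R y ^ k) sums (sqrt_compl y * sqrt_compl y)"
    by (simp add: sqrt_compl_def)
  moreover have "(\<lambda>k. ((1 gchoose k) * (- 1) ^ k) *\<^sub>R y ^ k) sums (\<Sum>k<2. ((1 gchoose k) * (- 1) ^ k :: real) *\<^sub>R y ^ k)"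
  proof (rule sums_finite)
    fix k :: nat assume "k \<notin> {..<2}"
    then have "((1::real) gchoose k) = 0"
      using binomial_gbinomial[of 1 k, where ?'a = real] by (simp add: binomial_eq_0)
    then show "(((1::real) gchoose k) * (- 1) ^ k) *\<^sub>R y ^ k = 0" by simp
  qed simp
  ultimately have "sqrt_compl y * sqrt_compl y = (\<Sum>k<2. ((1 gchoose k) * (- 1) ^ k :: real) *\<^sub>R y ^ k)"
    by (rule sums_unique2)
  then show ?thesis by (simp add: eval_nat_numeral)
qed

lemma sqrt_compl_commute:
  fixes y :: "'a::{real_normed_algebra_1,banach}"
  assumes "norm y \<le> 1" "x * y = y * x"
  shows "x * sqrt_compl y = sqrt_compl y * x"
proof -
  have c: "x * y ^ n = y ^ n * x" for n
    by (induction n) (auto simp: assms(2) mult.assoc[symmetric], metis assms(2) mult.assoc)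
  have "(\<lambda>n. x * (sqrt_coeff n *\<^sub>R y ^ n)) sums (x * sqrt_compl y)"
    by (intro sums_mult sqrt_compl_sums assms)
  moreover have "(\<lambda>n. (sqrt_coeff n *\<^sub>R y ^ n) * x) sums (sqrt_compl y * x)"
    by (intro sums_mult2 sqrt_compl_sums assms)
  ultimately show ?thesis using sums_unique2 by (fastforce simp: c)
qed

lemma sqrt_compl_norm:
  fixes y :: "'a::{real_normed_algebra_1,banach}"
  assumes "norm y \<le> 1"
  shows "norm (1 - sqrt_compl y) \<le> 1"
proof -
  let ?t = "\<lambda>n. sqrt_coeff n *\<^sub>R y ^ n"
  have s: "(\<lambda>n. ?t (Suc n)) sums (sqrt_compl y - 1)"
    using sqrt_compl_sums(2)[OF assms] by (subst sums_Suc_iff) simp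
  have "(\<lambda>n. norm (\<Sum>k<n. ?t (Suc k))) \<longlonglongrightarrow> norm (sqrt_compl y - 1)"
    using s unfolding sums_def by (rule tendsto_norm)
  moreover have "norm (\<Sum>k<n. ?t (Suc k)) \<le> 1" for n
  proof -
    have "norm (\<Sum>k<n. ?t (Suc k)) \<le> (\<Sum>k<n. \<bar>sqrt_coeff (Suc k)\<bar>)"
      by (rule sum_norm_le) (use norm_sqrt_term_le[OF assms] in blast)
    then show ?thesis using sqrt_coeff_tail_sum[of n] by linarith
  qed
  ultimately have "norm (sqrt_compl y - 1) \<le> 1"
    by (intro LIMSEQ_le_const2) auto
  then show ?thesis by (simp add: norm_minus_commute)
qed

lemma sqrt_compl_star:
  fixes y :: "'a::cstar_algebra"
  assumes "norm y \<le> 1" "y\<^sup>\<star> = y"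
  shows "(sqrt_compl y)\<^sup>\<star> = sqrt_compl y"
proof -
  have "(\<lambda>n. (sqrt_coeff n *\<^sub>R y ^ n)\<^sup>\<star>) sums (sqrt_compl y)\<^sup>\<star>"
    by (intro bounded_linear.sums[OF bounded_linear_star] sqrt_compl_sums assms)
  then show ?thesis using sqrt_compl_sums(2)[OF assms(1)] sums_unique2
    by (fastforce simp: star_scaleR star_power assms)
qed

text \<open>
  For self-adjoint \<open>k\<close> in the unit ball put \<open>c = sqrt (1 - k\<^sup>2)\<close>. Then \<open>k + \<i>c\<close> is unitary, so its
  imaginary part \<open>c\<close> is a contraction as well. This replaces the spectral mapping theorem.
\<close>
lemma norm_one_minus_square_le:
  fixes k :: "'a::cstar_algebra"
  assumes "k\<^sup>\<star> = k" "norm k \<le> 1"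
  shows "norm (1 - k * k) \<le> 1"
proof -
  have n: "norm (k * k) \<le> 1"
    using norm_mult_ineq[of k k] mult_le_one[OF assms(2) _ assms(2)] by simp
  define c where "c = sqrt_compl (k * k)"
  have cc: "c * c = 1 - k * k" unfolding c_def by (rule sqrt_compl_square[OF n])
  have cs: "c\<^sup>\<star> = c" unfolding c_def by (rule sqrt_compl_star[OF n]) (simp add: star_mult assms)
  have ck: "k * c = c * k" unfolding c_def by (rule sqrt_compl_commute[OF n]) (simp add: mult.assoc)
  define v where "v = k + \<i> *\<^sub>C c"
  have vs: "v\<^sup>\<star> = k - \<i> *\<^sub>C c"
    by (simp add: v_def star_add star_scaleC assms cs scaleC_minus_left)
  have "v\<^sup>\<star> * v = k * k - \<i> *\<^sub>C (\<i> *\<^sub>C (c * c))"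
    unfolding vs unfolding v_def
    by (simp add: algebra_simps mult_scaleC_left mult_scaleC_right ck scaleC_diff_right scaleC_add_right)
  also have "\<dots> = 1" by (simp add: scaleC_scaleC scaleC_minus_one cc)
  finally have "(norm v)\<^sup>2 = 1" using cstar_identity[of v] by simp
  then have nv: "norm v = 1" using norm_ge_zero[of v] by (simp add: power2_eq_1_iff)
  have "v - v\<^sup>\<star> = \<i> *\<^sub>C c + \<i> *\<^sub>C c" unfolding vs by (simp add: v_def)
  then have "v - v\<^sup>\<star> = (2 * \<i>) *\<^sub>C c" by (simp add: scaleC_add_left[symmetric])
  then have "2 * norm c = norm (v - v\<^sup>\<star>)" by (simp add: norm_scaleC norm_mult)
  also have "\<dots> \<le> 2" using norm_triangle_ineq4[of v "v\<^sup>\<star>"] nv by simp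
  finally have "norm c \<le> 1" by simp
  then have "norm (c * c) \<le> 1"
    using norm_mult_ineq[of c c] mult_le_one[of "norm c" "norm c"] by simp
  then show ?thesis by (simp add: cc)
qed

section \<open>States\<close>

lemma state_add: "state \<phi> \<Longrightarrow> \<phi> (a + b) = \<phi> a + \<phi> b"
  and state_scaleC: "state \<phi> \<Longrightarrow> \<phi> (c *\<^sub>C a) = c * \<phi> a"
  and state_one: "state \<phi> \<Longrightarrow> \<phi> 1 = 1"
  and state_pos: "state \<phi> \<Longrightarrow> \<phi> (a\<^sup>\<star> * a) \<in> \<real>\<^sub>\<ge>\<^sub>0"
  by (auto simp: state_def)

lemma state_scaleR: "state \<phi> \<Longrightarrow> \<phi> (r *\<^sub>R a) = complex_of_real r * \<phi> a"
  by (metis scaleC_of_real state_scaleC)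

lemma state_minus: "state \<phi> \<Longrightarrow> \<phi> (- a) = - \<phi> a"
  using state_scaleC[of \<phi> "- 1" a] by (simp add: scaleC_minus_one)

lemma state_diff: "state \<phi> \<Longrightarrow> \<phi> (a - b) = \<phi> a - \<phi> b"
  using state_add[of \<phi> a "- b"] by (simp add: state_minus)

lemma state_zero: "state \<phi> \<Longrightarrow> \<phi> 0 = 0"
  using state_diff[of \<phi> 0 0] by simp

lemma state_sum: "state \<phi> \<Longrightarrow> \<phi> (\<Sum>i\<in>I. f i) = (\<Sum>i\<in>I. \<phi> (f i))"
  by (induction I rule: infinite_finite_induct) (auto simp: state_zero state_add)

text \<open>Inside the unit ball, \<open>1 - h\<close> is the square of a self-adjoint element.\<close>
lemma state_selfadjoint_le_one:
  fixes h :: "'a::cstar_algebra"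
  assumes "state \<phi>" "h\<^sup>\<star> = h" "norm h \<le> 1"
  shows "\<phi> h \<in> \<real>" "Re (\<phi> h) \<le> 1"
proof -
  have "\<phi> (1 - h) \<in> \<real>\<^sub>\<ge>\<^sub>0"
    using state_pos[OF assms(1), of "sqrt_compl h"] sqrt_compl_square[OF assms(3)]
      sqrt_compl_star[OF assms(3,2)] by simp
  then have *: "1 - \<phi> h \<in> \<real>\<^sub>\<ge>\<^sub>0" by (simp add: state_diff[OF assms(1)] state_one[OF assms(1)])
  then show "\<phi> h \<in> \<real>" by (auto simp: complex_nonneg_Reals_iff complex_is_Real_iff)
  from * show "Re (\<phi> h) \<le> 1" by (auto simp: complex_nonneg_Reals_iff)
qed

lemma state_selfadjoint:
  fixes h :: "'a::cstar_algebra"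
  assumes "state \<phi>" "h\<^sup>\<star> = h"
  shows "\<phi> h \<in> \<real>" "norm (\<phi> h) \<le> norm h"
proof -
  have "\<phi> h \<in> \<real> \<and> norm (\<phi> h) \<le> norm h"
  proof (cases "h = 0")
    case True
    then show ?thesis using state_zero[OF assms(1)] by simp
  next
    case False
    define r where "r = inverse (norm h)"
    have r: "r > 0" "r * norm h = 1" using False by (auto simp: r_def)
    have n: "norm (r *\<^sub>R h) \<le> 1" "norm (- (r *\<^sub>R h)) \<le> 1" using r by auto
    have s: "(r *\<^sub>R h)\<^sup>\<star> = r *\<^sub>R h" "(- (r *\<^sub>R h))\<^sup>\<star> = - (r *\<^sub>R h)"
      by (simp_all add: star_scaleR star_minus assms)
    note a = state_selfadjoint_le_one[OF assms(1) s(1) n(1)]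
    note b = state_selfadjoint_le_one[OF assms(1) s(2) n(2)]
    have re: "\<phi> h \<in> \<real>" using a(1) r by (simp add: state_scaleR[OF assms(1)] complex_is_Real_iff)
    have "r * \<bar>Re (\<phi> h)\<bar> \<le> r * norm h"
      using a(2) b(2) r by (simp add: state_scaleR[OF assms(1)] state_minus[OF assms(1)] abs_if)
    then have "\<bar>Re (\<phi> h)\<bar> \<le> norm h" using r(1) by simp
    then show ?thesis using re by (simp add: in_Reals_norm)
  qed
  then show "\<phi> h \<in> \<real>" "norm (\<phi> h) \<le> norm h" by auto
qed

lemma cartesian_decomposition:
  fixes a :: "'a::cstar_algebra"
  obtains x y where "a = x + \<i> *\<^sub>C y" "x\<^sup>\<star> = x" "y\<^sup>\<star> = y" "norm x \<le> norm a" "norm y \<le> norm a"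
proof -
  let ?x = "(1/2::complex) *\<^sub>C (a + a\<^sup>\<star>)" and ?y = "(-\<i>/2) *\<^sub>C (a - a\<^sup>\<star>)"
  have "?x + \<i> *\<^sub>C ?y = (1/2::complex) *\<^sub>C ((a + a\<^sup>\<star>) + (a - a\<^sup>\<star>))"
    by (simp only: scaleC_scaleC scaleC_add_right[of _ "a + a\<^sup>\<star>"]) simp
  also have "(a + a\<^sup>\<star>) + (a - a\<^sup>\<star>) = a + a" by simp
  also have "(1/2::complex) *\<^sub>C (a + a) = (1/2 + 1/2::complex) *\<^sub>C a"
    by (simp only: scaleC_add_left scaleC_add_right)
  finally have "a = ?x + \<i> *\<^sub>C ?y" by simp
  moreover have "?x\<^sup>\<star> = ?x" by (simp add: star_scaleC star_add star_star add.commute)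
  moreover have "?y\<^sup>\<star> = (\<i>/2) *\<^sub>C - (a - a\<^sup>\<star>)" by (simp add: star_scaleC star_diff star_star)
  then have "?y\<^sup>\<star> = ?y" by (simp only: scaleC_minus_right) (simp add: scaleC_minus_left)
  moreover have "norm ?x \<le> norm a"
    using norm_triangle_ineq[of a "a\<^sup>\<star>"] by (simp add: norm_scaleC norm_divide)
  moreover have "norm ?y \<le> norm a"
    using norm_triangle_ineq4[of a "a\<^sup>\<star>"] by (simp add: norm_scaleC norm_divide)
  ultimately show thesis by (rule that)
qed

lemma state_star:
  fixes a :: "'a::cstar_algebra"
  assumes "state \<phi>"
  shows "\<phi> (a\<^sup>\<star>) = cnj (\<phi> a)"
proof -
  obtain x y where xy: "a = x + \<i> *\<^sub>C y" "x\<^sup>\<star> = x" "y\<^sup>\<star> = y" by (rule cartesian_decomposition)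
  then have "a\<^sup>\<star> = x - \<i> *\<^sub>C y" by (simp add: star_add star_scaleC scaleC_minus_left)
  moreover have "\<phi> x \<in> \<real>" "\<phi> y \<in> \<real>" using state_selfadjoint[OF assms] xy by auto
  ultimately show ?thesis
    by (simp add: xy(1) state_diff[OF assms] state_add[OF assms] state_scaleC[OF assms] Reals_cnj_iff)
qed

lemma state_norm_le:
  fixes a :: "'a::cstar_algebra"
  assumes "state \<phi>"
  shows "norm (\<phi> a) \<le> 2 * norm a"
proof -
  obtain x y where xy: "a = x + \<i> *\<^sub>C y" "x\<^sup>\<star> = x" "y\<^sup>\<star> = y" "norm x \<le> norm a" "norm y \<le> norm a"
    by (rule cartesian_decomposition)
  have "\<phi> a = \<phi> x + \<i> * \<phi> y" by (simp add: xy(1) state_add[OF assms] state_scaleC[OF assms])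
  then have "norm (\<phi> a) \<le> norm (\<phi> x) + norm (\<phi> y)"
    using norm_triangle_ineq[of "\<phi> x" "\<i> * \<phi> y"] by (simp add: norm_mult)
  then show ?thesis
    using state_selfadjoint(2)[OF assms xy(2)] state_selfadjoint(2)[OF assms xy(3)] xy(4,5) by linarith
qed

lemma state_bounded_linear:
  fixes \<phi> :: "'a::cstar_algebra \<Rightarrow> complex"
  assumes "state \<phi>"
  shows "bounded_linear \<phi>"
proof (rule bounded_linear_intro[where K = 2])
  show "\<phi> (r *\<^sub>R a) = r *\<^sub>R \<phi> a" for r a
    by (rule trans[OF state_scaleR[OF assms] scaleR_conv_of_real[symmetric]])
qed (use state_norm_le[OF assms] in \<open>auto simp: state_add[OF assms] mult.commute\<close>)

text \<open>
  A faithful state detects positivity of self-adjoint elements. Write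
  \<open>\<bar>k\<bar> = sqrt (1 - (1 - k\<^sup>2))\<close> and let \<open>b = \<bar>k\<bar> - k\<close> be (twice) the negative part of \<open>k\<close>. From \<open>\<bar>k\<bar>\<^sup>2 = k\<^sup>2\<close> one
  gets \<open>k b = - \<bar>k\<bar> b\<close>, so that \<open>\<tau> (b k b) \<ge> 0\<close> forces \<open>\<tau> (b \<bar>k\<bar> b) = 0\<close> and hence \<open>b = 0\<close>. Only vectors \<open>b\<close>
  in the closed span of the powers of \<open>k\<close> are involved; this span may be replaced by any
  subspace that contains \<open>1\<close> and is invariant under left multiplication by \<open>k\<close>.
\<close>
lemma faithful_state_detects_positivity_unit_ball:
  fixes k :: "'a::cstar_algebra"
  assumes "cstar_probability_space \<tau>" "state \<phi>" "k\<^sup>\<star> = k" "norm k \<le> 1"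
    and V: "1 \<in> V" "\<And>b. b \<in> V \<Longrightarrow> k * b \<in> V" "\<And>b c. b \<in> V \<Longrightarrow> c \<in> V \<Longrightarrow> b + c \<in> V"
      "\<And>b r. b \<in> V \<Longrightarrow> r *\<^sub>R b \<in> V"
    and pos: "\<And>b. b \<in> V \<Longrightarrow> Re (\<tau> (b\<^sup>\<star> * k * b)) \<ge> 0"
  shows "Re (\<phi> k) \<ge> 0"
proof -
  have st: "state \<tau>" and faithful: "\<And>a. \<tau> (a\<^sup>\<star> * a) = 0 \<Longrightarrow> a = 0"
    using assms(1) by (auto simp: cstar_probability_space_def)
  define y where "y = 1 - k * k"
  have ny: "norm y \<le> 1" unfolding y_def by (rule norm_one_minus_square_le[OF assms(3,4)])
  have ys: "y\<^sup>\<star> = y" by (simp add: y_def star_diff star_mult assms)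
  have yk: "k * y = y * k" by (simp add: y_def algebra_simps)
  define m where "m = sqrt_compl y"
  have mm: "m * m = k * k" unfolding m_def using sqrt_compl_square[OF ny] by (simp add: y_def)
  have ms: "m\<^sup>\<star> = m" unfolding m_def by (rule sqrt_compl_star[OF ny ys])
  have mk: "k * m = m * k" unfolding m_def by (rule sqrt_compl_commute[OF ny yk])
  have nm: "norm (1 - m) \<le> 1" unfolding m_def by (rule sqrt_compl_norm[OF ny])
  define d where "d = sqrt_compl (1 - m)"
  have dd: "d * d = m" unfolding d_def using sqrt_compl_square[OF nm] by simp
  have ds: "d\<^sup>\<star> = d" unfolding d_def by (rule sqrt_compl_star[OF nm]) (simp add: star_diff ms)
  define b where "b = m - k"
  have bs: "b\<^sup>\<star> = b" by (simp add: b_def star_diff ms assms)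
  have kb: "k * b = - (m * b)" by (simp add: b_def algebra_simps mk mm)
  have neg_V: "c - e \<in> V" if "c \<in> V" "e \<in> V" for c e
    using V(3)[OF that(1) V(4)[OF that(2), of "- 1"]] by simp
  have pow_V: "y ^ n \<in> V" for n
    by (induction n)
       (auto simp: V(1) y_def left_diff_distrib mult.assoc intro!: neg_V V(2))
  define s where "s n = (\<Sum>j<n. sqrt_coeff j *\<^sub>R y ^ j) - k" for n
  have kV: "k \<in> V" using V(2)[OF V(1)] by simp
  have zV: "0 \<in> V" using V(4)[OF V(1), of 0] by simp
  have "(\<Sum>j<n. sqrt_coeff j *\<^sub>R y ^ j) \<in> V" for n
    by (induction n) (auto simp: zV intro!: V(3,4) pow_V)
  then have sV: "s n \<in> V" for n unfolding s_def by (intro neg_V kV)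
  have s_lim: "s \<longlonglongrightarrow> b"
    unfolding s_def b_def m_def
    by (intro tendsto_intros) (use sqrt_compl_sums(2)[OF ny] in \<open>simp add: sums_def\<close>)
  have "(\<lambda>n. Re (\<tau> ((s n)\<^sup>\<star> * k * s n))) \<longlonglongrightarrow> Re (\<tau> (b\<^sup>\<star> * k * b))"
    by (intro tendsto_intros bounded_linear.tendsto[OF state_bounded_linear[OF st]]
        bounded_linear.tendsto[OF bounded_linear_star] s_lim)
  then have "0 \<le> Re (\<tau> (b\<^sup>\<star> * k * b))"
    by (rule LIMSEQ_le_const) (use pos[OF sV] in auto)
  moreover have "b\<^sup>\<star> * k * b = - ((d * b)\<^sup>\<star> * (d * b))"
    by (simp add: star_mult bs ds mult.assoc kb) (simp add: dd flip: mult.assoc)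
  ultimately have "Re (\<tau> ((d * b)\<^sup>\<star> * (d * b))) \<le> 0" by (simp add: state_minus[OF st])
  moreover have "\<tau> ((d * b)\<^sup>\<star> * (d * b)) \<in> \<real>\<^sub>\<ge>\<^sub>0" by (rule state_pos[OF st])
  ultimately have "\<tau> ((d * b)\<^sup>\<star> * (d * b)) = 0"
    by (auto simp: complex_nonneg_Reals_iff complex_eq_iff)
  then have "d * b = 0" by (rule faithful)
  then have "d * (d * b) = 0" by simp
  then have "m * b = 0" by (simp flip: mult.assoc add: dd)
  then have "b\<^sup>\<star> * b = 0" using kb by (simp add: bs, subst b_def) (simp add: left_diff_distrib)
  then have "b = 0" by (rule star_eq_zero_if)
  then have "k = d\<^sup>\<star> * d" by (simp add: b_def ds dd)
  then show ?thesis using state_pos[OF assms(2), of d] by (simp add: complex_nonneg_Reals_iff)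
qed

lemma faithful_state_detects_positivity:
  fixes k :: "'a::cstar_algebra"
  assumes "cstar_probability_space \<tau>" "state \<phi>" "k\<^sup>\<star> = k"
    and V: "1 \<in> V" "\<And>b. b \<in> V \<Longrightarrow> k * b \<in> V" "\<And>b c. b \<in> V \<Longrightarrow> c \<in> V \<Longrightarrow> b + c \<in> V"
      "\<And>b r. b \<in> V \<Longrightarrow> r *\<^sub>R b \<in> V"
    and pos: "\<And>b. b \<in> V \<Longrightarrow> Re (\<tau> (b\<^sup>\<star> * k * b)) \<ge> 0"
  shows "Re (\<phi> k) \<ge> 0"
proof (cases "k = 0")
  case True
  then show ?thesis using state_zero[OF assms(2)] by simp
next
  case False
  define r where "r = inverse (norm k)"
  have r: "r > 0" "norm (r *\<^sub>R k) \<le> 1" using False by (auto simp: r_def)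
  have st: "state \<tau>" using assms(1) by (simp add: cstar_probability_space_def)
  have "Re (\<phi> (r *\<^sub>R k)) \<ge> 0"
  proof (rule faithful_state_detects_positivity_unit_ball[OF assms(1,2) _ r(2) V(1) _ V(3,4)])
    show "(r *\<^sub>R k)\<^sup>\<star> = r *\<^sub>R k" by (simp add: star_scaleR assms)
    show "(r *\<^sub>R k) * b \<in> V" if "b \<in> V" for b using V(2,4) that by simp
    show "Re (\<tau> (b\<^sup>\<star> * (r *\<^sub>R k) * b)) \<ge> 0" if "b \<in> V" for b
      using pos[OF that] r(1) by (simp add: state_scaleR[OF st])
  qed
  then show ?thesis using r(1) by (simp add: state_scaleR[OF assms(2)] zero_le_mult_iff)
qed

section \<open>Reduced words in free Haar unitaries\<close>

text \<open>The letter \<open>(i, True)\<close> stands for the \<open>i\<close>-th generator, \<open>(i, False)\<close> for its inverse.\<close>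
definition inv_letter :: "'n \<times> bool \<Rightarrow> 'n \<times> bool" where
  "inv_letter a = (fst a, \<not> snd a)"

definition reduced :: "('n \<times> bool) list \<Rightarrow> bool" where
  "reduced = successively (\<lambda>a b. b \<noteq> inv_letter a)"

definition letter :: "'a::cstar_algebra ^ 'n \<Rightarrow> 'n \<times> bool \<Rightarrow> 'a" where
  "letter u a = (if snd a then u $ fst a else (u $ fst a)\<^sup>\<star>)"

definition word :: "'a::cstar_algebra ^ 'n \<Rightarrow> ('n \<times> bool) list \<Rightarrow> 'a" where
  "word u w = prod_list (map (letter u) w)"

lemma fst_inv_letter [simp]: "fst (inv_letter a) = fst a"
  and inv_inv_letter [simp]: "inv_letter (inv_letter a) = a"
  by (cases a; simp add: inv_letter_def)+

lemma inv_letter_eq_iff: "inv_letter a = b \<longleftrightarrow> a = inv_letter b"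
  by auto

lemma reduced_Nil [simp]: "reduced []"
  by (simp add: reduced_def)

lemma reduced_Cons: "reduced (a # w) \<longleftrightarrow> (w = [] \<or> hd w \<noteq> inv_letter a) \<and> reduced w"
  by (auto simp: reduced_def successively_Cons)

lemma reduced_tl: "reduced w \<Longrightarrow> reduced (tl w)"
  by (cases w) (auto simp: reduced_Cons)

lemma word_Nil [simp]: "word u [] = 1"
  and word_Cons: "word u (a # w) = letter u a * word u w"
  and word_append: "word u (v @ w) = word u v * word u w"
  by (simp_all add: word_def)

lemma letter_star: "(letter u a)\<^sup>\<star> = letter u (inv_letter a)"
  by (simp add: letter_def inv_letter_def star_star)

lemma word_star: "(word u w)\<^sup>\<star> = word u (map inv_letter (rev w))"
  by (induction w) (auto simp: word_Cons word_append star_mult letter_star)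

lemma letter_cancel:
  assumes "unitary (u $ fst a)"
  shows "letter u (inv_letter a) * letter u a = 1"
  using assms by (auto simp: letter_def inv_letter_def unitary_def)

lemma unitary_power_step:
  shows "k > 0 \<Longrightarrow> unitary_power v (k + 1) = v * unitary_power v k"
    and "k < 0 \<Longrightarrow> unitary_power v (k - 1) = v\<^sup>\<star> * unitary_power v k"
proof -
  show "unitary_power v (k + 1) = v * unitary_power v k" if "k > 0"
    using that by (simp add: unitary_power_def nat_add_distrib)
  show "unitary_power v (k - 1) = v\<^sup>\<star> * unitary_power v k" if "k < 0"
  proof -
    have "nat (1 - k) = Suc (nat (- k))" using that by simp
    then show ?thesis using that by (simp add: unitary_power_def)
  qed
qed

lemma unitary_power_one: "unitary_power v 1 = v" "unitary_power v (- 1) = v\<^sup>\<star>"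
  by (simp_all add: unitary_power_def)

text \<open>
  Freeness speaks about alternating products of elements of different subalgebras. Collecting
  equal neighbouring letters of a reduced word turns it into such a product, with
  nontrivial powers as factors. The sign of the first exponent is recorded because it excludes
  cancellation when a further letter is put in front.
\<close>
lemma reduced_word_syllables:
  assumes "reduced w"
  shows "\<exists>l. word u w = prod_list (map (\<lambda>p. unitary_power (u $ fst p) (snd p)) l)
    \<and> successively (\<lambda>p q. fst p \<noteq> fst q) l \<and> (\<forall>p\<in>set l. snd p \<noteq> 0) \<and> (l = [] \<longleftrightarrow> w = [])
    \<and> (w \<noteq> [] \<longrightarrow> fst (hd l) = fst (hd w) \<and> (snd (hd l) > 0 \<longleftrightarrow> snd (hd w)))"
  using assms
proof (induction w)
  case Nil
  then show ?case by (intro exI[of _ "[]"]) auto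
next
  case (Cons a w)
  from Cons.prems have rw: "reduced w" and aw: "w \<noteq> [] \<Longrightarrow> hd w \<noteq> inv_letter a"
    by (auto simp: reduced_Cons)
  from Cons.IH[OF rw] obtain l where
    l: "word u w = prod_list (map (\<lambda>p. unitary_power (u $ fst p) (snd p)) l)"
      "successively (\<lambda>p q. fst p \<noteq> fst q) l" "\<forall>p\<in>set l. snd p \<noteq> 0" "l = [] \<longleftrightarrow> w = []"
      "w \<noteq> [] \<Longrightarrow> fst (hd l) = fst (hd w) \<and> (snd (hd l) > 0 \<longleftrightarrow> snd (hd w))"
    by auto
  obtain i s where a: "a = (i, s)" by fastforce
  define e :: int where "e = (if s then 1 else - 1)"
  have e: "letter u a = unitary_power (u $ i) e"
    by (simp add: letter_def a e_def unitary_power_one)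
  show ?case
  proof (cases "w \<noteq> [] \<and> fst (hd w) = i")
    case False
    show ?thesis
      by (rule exI[of _ "(i, e) # l"])
         (use False l e in \<open>auto simp: word_Cons a successively_Cons e_def\<close>)
  next
    case True
    then obtain k l' where lk: "l = (i, k) # l'" using l(4,5) by (cases l) auto
    have sg: "k > 0 \<longleftrightarrow> s" "k \<noteq> 0"
      using True l(3,5) aw lk by (auto simp: a inv_letter_def prod_eq_iff)
    have "unitary_power (u $ i) (k + e) = letter u a * unitary_power (u $ i) k"
      using sg unitary_power_step[of k "u $ i"] by (cases s) (auto simp: e_def a letter_def)
    then show ?thesis
      by (intro exI[of _ "(i, k + e) # l'"])
         (use l lk sg in \<open>auto simp: word_Cons mult.assoc a e_def successively_Cons\<close>)
  qed
qed

lemma unitary_power_in_hull: "unitary_power v k \<in> star_subalgebra hull {v}"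
proof -
  have "unitary_power v k \<in> B" if B: "star_subalgebra B" "v \<in> B" for B
  proof -
    have "x ^ n \<in> B" if "x \<in> B" for x n
      using B that by (induction n) (auto simp: star_subalgebra_def)
    then show ?thesis using B by (auto simp: unitary_power_def star_subalgebra_def)
  qed
  then show ?thesis by (auto simp: hull_def)
qed

lemma free_haar_word_zero:
  assumes "free_haar_unitaries \<tau> u" "reduced w" "w \<noteq> []"
  shows "\<tau> (word u w) = 0"
proof -
  obtain l where
    l: "word u w = prod_list (map (\<lambda>p. unitary_power (u $ fst p) (snd p)) l)"
      "successively (\<lambda>p q. fst p \<noteq> fst q) l" "\<forall>p\<in>set l. snd p \<noteq> 0" "l \<noteq> []"
    using reduced_word_syllables[OF assms(2), of u] assms(3) by auto
  define x where "x k = unitary_power (u $ fst (l ! k)) (snd (l ! k))" for k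
  have free: "free_independent \<tau> u" and haar: "\<And>i k. k \<noteq> 0 \<Longrightarrow> \<tau> (unitary_power (u $ i) k) = 0"
    using assms(1) by (auto simp: free_haar_unitaries_def)
  have "\<tau> (prod_list (map x [0..<length l])) = 0"
  proof (rule free[unfolded free_independent_def, rule_format, where i = "\<lambda>k. fst (l ! k)"])
    show "1 \<le> length l" using l(4) by (cases l) auto
    show "fst (l ! k) \<noteq> fst (l ! (k + 1))" if "k + 1 < length l" for k
      using l(2) that by (auto simp: successively_conv_nth)
    show "x k \<in> star_subalgebra hull {u $ fst (l ! k)} \<and> \<tau> (x k) = 0" if "k < length l" for k
      unfolding x_def using l(3) that by (intro conjI unitary_power_in_hull haar) auto
  qed
  moreover have "map x [0..<length l] = map (\<lambda>p. unitary_power (u $ fst p) (snd p)) l"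
    by (rule nth_equalityI) (auto simp: x_def)
  ultimately show ?thesis using l(1) by simp
qed

lemma reduced_inverse: "reduced w \<Longrightarrow> reduced (map inv_letter (rev w))"
  unfolding reduced_def by (auto simp: successively_map inv_letter_eq_iff elim: successively_mono)

text \<open>
  In the GNS space of \<open>\<tau>\<close>, the reduced words are orthonormal: the \<open>*\<close>-algebra generated by \<open>u\<close>
  acts like the group algebra of the free group.
\<close>
lemma word_orthonormal:
  assumes "state \<tau>" "free_haar_unitaries \<tau> u" "reduced v" "reduced w"
  shows "\<tau> ((word u v)\<^sup>\<star> * word u w) = of_bool (v = w)"
  using assms(3,4)
proof (induction v arbitrary: w)
  case Nil
  show ?case using free_haar_word_zero[OF assms(2) Nil(2)] by (auto simp: state_one[OF assms(1)])
next
  case (Cons a v)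
  show ?case
  proof (cases "w \<noteq> [] \<and> hd w = a")
    case True
    then obtain w' where w: "w = a # w'" by (cases w) auto
    have "unitary (u $ fst a)" using assms(2) by (simp add: free_haar_unitaries_def)
    then have c: "letter u (inv_letter a) * letter u a = 1" by (rule letter_cancel)
    have "(word u (a # v))\<^sup>\<star> * word u w
        = (word u v)\<^sup>\<star> * (letter u (inv_letter a) * letter u a) * word u w'"
      by (simp add: w word_Cons star_mult letter_star mult.assoc)
    then show ?thesis using Cons.IH[of w'] Cons.prems by (simp add: c w reduced_Cons)
  next
    case False
    have "reduced (map inv_letter (rev (a # v)) @ w)"
      using reduced_inverse[OF Cons.prems(1)] Cons.prems(2) False
      unfolding reduced_def by (subst successively_append_iff) (auto simp: inv_letter_eq_iff)
    then have "\<tau> (word u (map inv_letter (rev (a # v)) @ w)) = 0"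
      by (intro free_haar_word_zero[OF assms(2)]) auto
    then have "\<tau> ((word u (a # v))\<^sup>\<star> * word u w) = 0" by (simp only: word_append word_star)
    then show ?thesis using False by auto
  qed
qed

section \<open>Sums over the tree of reduced words\<close>

definition ball_words :: "nat \<Rightarrow> ('n \<times> bool) list set" where
  "ball_words n = {w. reduced w \<and> length w \<le> n}"

definition sphere_words :: "nat \<Rightarrow> ('n \<times> bool) list set" where
  "sphere_words n = {w. reduced w \<and> length w = n}"

definition children :: "('n \<times> bool) list \<Rightarrow> ('n \<times> bool) set" where
  "children v = {a. reduced (a # v)}"

lemma finite_ball_words [simp]: "finite (ball_words n :: ('n::finite \<times> bool) list set)"
  by (rule finite_subset[OF _ finite_lists_length_le[of UNIV n]]) (auto simp: ball_words_def)

lemma finite_sphere_words [simp]: "finite (sphere_words n :: ('n::finite \<times> bool) list set)"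
  by (rule finite_subset[OF _ finite_ball_words[of n]]) (auto simp: ball_words_def sphere_words_def)

lemma ball_words_0 [simp]: "ball_words 0 = {[]}"
  and sphere_words_0 [simp]: "sphere_words 0 = {[]}"
  by (auto simp: ball_words_def sphere_words_def)

lemma Nil_in_ball_words [simp]: "[] \<in> ball_words n"
  by (simp add: ball_words_def)

lemma tl_in_ball_words: "w \<in> ball_words n \<Longrightarrow> tl w \<in> ball_words n"
  by (auto simp: ball_words_def reduced_tl)

lemma sum_ball_words_Suc:
  fixes f :: "('n::finite \<times> bool) list \<Rightarrow> 'b::comm_monoid_add"
  shows "sum f (ball_words (Suc n)) = sum f (ball_words n) + sum f (sphere_words (Suc n))"
proof -
  have "ball_words (Suc n) = ball_words n \<union> (sphere_words (Suc n) :: ('n \<times> bool) list set)"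
    by (auto simp: ball_words_def sphere_words_def)
  then show ?thesis
    by (simp only:, intro sum.union_disjoint finite_ball_words finite_sphere_words)
       (auto simp: ball_words_def sphere_words_def)
qed

lemma sum_ball_words_children:
  fixes f :: "('n::finite \<times> bool) list \<Rightarrow> 'b::comm_monoid_add"
  shows "(\<Sum>w\<in>ball_words (Suc n) - {[]}. f w) = (\<Sum>v\<in>ball_words n. \<Sum>a\<in>children v. f (a # v))"
proof -
  have "(\<Sum>v\<in>ball_words n. \<Sum>a\<in>children v. f (a # v))
      = (\<Sum>(v, a)\<in>(SIGMA v:ball_words n. children v). f (a # v))"
    by (rule sum.Sigma) auto
  also have "\<dots> = (\<Sum>w\<in>ball_words (Suc n) - {[]}. f w)"
    by (rule sum.reindex_bij_witness[where i = "\<lambda>w. (tl w, hd w)" and j = "\<lambda>(v, a). a # v"])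
       (auto simp: ball_words_def children_def reduced_Cons neq_Nil_conv)
  finally show ?thesis by simp
qed

lemma sum_sphere_words_children:
  fixes f :: "('n::finite \<times> bool) list \<Rightarrow> 'b::comm_monoid_add"
  shows "(\<Sum>w\<in>sphere_words (Suc n). f w) = (\<Sum>v\<in>sphere_words n. \<Sum>a\<in>children v. f (a # v))"
proof -
  have "(\<Sum>v\<in>sphere_words n. \<Sum>a\<in>children v. f (a # v))
      = (\<Sum>(v, a)\<in>(SIGMA v:sphere_words n. children v). f (a # v))"
    by (rule sum.Sigma) auto
  also have "\<dots> = (\<Sum>w\<in>sphere_words (Suc n). f w)"
    by (rule sum.reindex_bij_witness[where i = "\<lambda>w. (tl w, hd w)" and j = "\<lambda>(v, a). a # v"])
       (auto simp: sphere_words_def children_def reduced_Cons length_Suc_conv)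
  finally show ?thesis by simp
qed

text \<open>Only the inverse of the first letter of \<open>v\<close> cannot be put in front of \<open>v\<close>.\<close>
lemma sum_children:
  fixes q :: "'n::finite \<Rightarrow> real"
  assumes "reduced v"
  shows "(\<Sum>a\<in>children v. q (fst a)) = 2 * (\<Sum>i\<in>UNIV. q i) - (if v = [] then 0 else q (fst (hd v)))"
proof -
  have all: "(\<Sum>a\<in>UNIV. q (fst (a :: 'n \<times> bool))) = 2 * (\<Sum>i\<in>UNIV. q i)"
    by (simp add: UNIV_Times_UNIV[symmetric] sum.cartesian_product' UNIV_bool sum_distrib_left
        del: UNIV_Times_UNIV)
  show ?thesis
  proof (cases v)
    case Nil
    then have "children v = UNIV" by (auto simp: children_def reduced_Cons)
    then show ?thesis using all Nil by simp
  next
    case (Cons b v')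
    then have "children v = UNIV - {inv_letter b}"
      using assms by (auto simp: children_def reduced_Cons inv_letter_eq_iff)
    then show ?thesis using all Cons by (simp add: sum_diff1)
  qed
qed

section \<open>The quadratic form of a linear combination of the generators\<close>

definition combination :: "'a::cstar_algebra ^ 'n::finite \<Rightarrow> nat \<Rightarrow> (('n \<times> bool) list \<Rightarrow> complex) \<Rightarrow> 'a" where
  "combination u n c = (\<Sum>w\<in>ball_words n. c w *\<^sub>C word u w)"

lemma state_sesquilinear:
  fixes u :: "'a::cstar_algebra ^ 'n::finite"
  assumes "state \<tau>"
  shows "\<tau> ((combination u n c)\<^sup>\<star> * x * combination u n c)
    = (\<Sum>v\<in>ball_words n. \<Sum>w\<in>ball_words n. cnj (c v) * c w * \<tau> ((word u v)\<^sup>\<star> * x * word u w))"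
proof -
  have "(combination u n c)\<^sup>\<star> * x * combination u n c
      = (\<Sum>v\<in>ball_words n. \<Sum>w\<in>ball_words n. (cnj (c v) * c w) *\<^sub>C ((word u v)\<^sup>\<star> * x * word u w))"
    unfolding combination_def
    by (subst sum.swap)
       (simp add: star_sum star_scaleC sum_distrib_left sum_distrib_right mult_scaleC_left
        mult_scaleC_right scaleC_sum_right scaleC_scaleC mult.commute)
  then show ?thesis by (simp add: state_sum[OF assms] state_scaleC[OF assms])
qed

lemma combination_norm:
  fixes u :: "'a::cstar_algebra ^ 'n::finite"
  assumes "state \<tau>" "free_haar_unitaries \<tau> u"
  shows "\<tau> ((combination u n c)\<^sup>\<star> * combination u n c) = of_real (\<Sum>w\<in>ball_words n. (cmod (c w))\<^sup>2)"
proof -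
  have "\<tau> ((combination u n c)\<^sup>\<star> * combination u n c)
      = (\<Sum>v\<in>ball_words n. \<Sum>w\<in>ball_words n. cnj (c v) * c w * \<tau> ((word u v)\<^sup>\<star> * word u w))"
    using state_sesquilinear[OF assms(1), where x = 1] by simp
  also have "\<dots> = (\<Sum>v\<in>ball_words n. \<Sum>w\<in>ball_words n. if v = w then cnj (c v) * c v else 0)"
    by (intro sum.cong refl) (auto simp: ball_words_def word_orthonormal[OF assms])
  also have "\<dots> = (\<Sum>v\<in>ball_words n. of_real ((cmod (c v))\<^sup>2))"
    by (simp add: complex_norm_square mult.commute del: of_real_power)
  finally show ?thesis by simp
qed

text \<open>
  Left multiplication by a generator either lengthens \<open>w\<close> or cancels its first letter. Both terms
  cannot be \<open>1\<close> at once, since \<open>v\<close> would then start with a letter followed by its inverse.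
\<close>
lemma generator_matrix_entry:
  assumes "state \<tau>" "free_haar_unitaries \<tau> u" "reduced v" "reduced w"
  shows "\<tau> ((word u v)\<^sup>\<star> * u $ i * word u w)
    = of_bool (v \<noteq> [] \<and> hd v = (i, True) \<and> w = tl v) + of_bool (w \<noteq> [] \<and> hd w = (i, False) \<and> v = tl w)"
proof (cases "w \<noteq> [] \<and> hd w = (i, False)")
  case True
  then obtain w' where w: "w = (i, False) # w'" by (cases w) auto
  have "unitary (u $ i)" using assms(2) by (simp add: free_haar_unitaries_def)
  then have "u $ i * (u $ i)\<^sup>\<star> = 1" by (simp add: unitary_def)
  then have "u $ i * word u w = word u w'"
    by (simp add: w word_Cons letter_def flip: mult.assoc)
  then have "\<tau> ((word u v)\<^sup>\<star> * u $ i * word u w) = of_bool (v = w')"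
    using word_orthonormal[OF assms(1,2,3), of w'] assms(4) by (simp add: mult.assoc w reduced_Cons)
  moreover have "\<not> (v \<noteq> [] \<and> hd v = (i, True) \<and> w = tl v)"
    using assms(3) by (cases v) (auto simp: w reduced_Cons inv_letter_def)
  ultimately show ?thesis by (auto simp: w)
next
  case False
  have "u $ i * word u w = word u ((i, True) # w)" by (simp add: word_Cons letter_def)
  moreover have "reduced ((i, True) # w)"
    using False assms(4) by (auto simp: reduced_Cons inv_letter_def)
  ultimately have "\<tau> ((word u v)\<^sup>\<star> * u $ i * word u w) = of_bool (v = (i, True) # w)"
    using word_orthonormal[OF assms(1,2,3)] by (simp add: mult.assoc)
  moreover have "v = (i, True) # w \<longleftrightarrow> v \<noteq> [] \<and> hd v = (i, True) \<and> w = tl v"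
    by (cases v) auto
  ultimately show ?thesis using False by auto
qed

lemma generator_form:
  fixes u :: "'a::cstar_algebra ^ 'n::finite"
  assumes "state \<tau>" "free_haar_unitaries \<tau> u"
  shows "\<tau> ((combination u n c)\<^sup>\<star> * u $ i * combination u n c)
    = (\<Sum>w\<in>ball_words n - {[]}. of_bool (hd w = (i, True)) * (cnj (c w) * c (tl w))
          + of_bool (hd w = (i, False)) * (cnj (c (tl w)) * c w))"
proof -
  let ?B = "ball_words n :: ('n \<times> bool) list set"
  have "\<tau> ((combination u n c)\<^sup>\<star> * u $ i * combination u n c)
      = (\<Sum>v\<in>?B. \<Sum>w\<in>?B. cnj (c v) * c w * of_bool (v \<noteq> [] \<and> hd v = (i, True) \<and> w = tl v))
        + (\<Sum>v\<in>?B. \<Sum>w\<in>?B. cnj (c v) * c w * of_bool (w \<noteq> [] \<and> hd w = (i, False) \<and> v = tl w))"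
    unfolding state_sesquilinear[OF assms(1)] sum.distrib[symmetric] distrib_left[symmetric]
    by (intro sum.cong refl arg_cong2[where f = "(*)"] generator_matrix_entry assms)
       (auto simp: ball_words_def)
  also have "(\<Sum>v\<in>?B. \<Sum>w\<in>?B. cnj (c v) * c w * of_bool (v \<noteq> [] \<and> hd v = (i, True) \<and> w = tl v))
      = (\<Sum>v\<in>?B. \<Sum>w\<in>?B. if w = tl v then of_bool (v \<noteq> [] \<and> hd v = (i, True)) * (cnj (c v) * c w) else 0)"
    by (intro sum.cong) auto
  also have "\<dots> = (\<Sum>v\<in>?B. of_bool (v \<noteq> [] \<and> hd v = (i, True)) * (cnj (c v) * c (tl v)))"
    by (intro sum.cong refl) (simp add: tl_in_ball_words)
  also have "(\<Sum>v\<in>?B. \<Sum>w\<in>?B. cnj (c v) * c w * of_bool (w \<noteq> [] \<and> hd w = (i, False) \<and> v = tl w))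
      = (\<Sum>w\<in>?B. \<Sum>v\<in>?B. if v = tl w then of_bool (w \<noteq> [] \<and> hd w = (i, False)) * (cnj (c v) * c w) else 0)"
    by (subst sum.swap, intro sum.cong) auto
  also have "\<dots> = (\<Sum>w\<in>?B. of_bool (w \<noteq> [] \<and> hd w = (i, False)) * (cnj (c (tl w)) * c w))"
    by (intro sum.cong refl) (simp add: tl_in_ball_words)
  also have "(\<Sum>v\<in>?B. of_bool (v \<noteq> [] \<and> hd v = (i, True)) * (cnj (c v) * c (tl v)))
      + (\<Sum>w\<in>?B. of_bool (w \<noteq> [] \<and> hd w = (i, False)) * (cnj (c (tl w)) * c w))
    = (\<Sum>w\<in>?B - {[]}. of_bool (hd w = (i, True)) * (cnj (c w) * c (tl w))
          + of_bool (hd w = (i, False)) * (cnj (c (tl w)) * c w))"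
    unfolding sum.distrib[symmetric]
  proof (rule sum.mono_neutral_cong_right[OF finite_ball_words])
    show "ball_words n - {[]} \<subseteq> (ball_words n :: ('n \<times> bool) list set)" by blast
  qed simp_all
  finally show ?thesis .
qed

lemma sum_plus_cnj: "(\<Sum>i\<in>I. f i + cnj (f i)) / 2 = of_real (Re (\<Sum>i\<in>I. f i))"
  by (simp add: complex_eq_iff sum.distrib sum_negf)

text \<open>
  The self-adjoint part of \<open>\<Sum>i. z i * u i\<close>. The support function of the numerical range in
  direction \<open>z\<close> is the supremum of its values at states.
\<close>
definition re_sum :: "'a::cstar_algebra ^ 'n::finite \<Rightarrow> complex ^ 'n \<Rightarrow> 'a" where
  "re_sum u z = (1/2::complex) *\<^sub>C (\<Sum>i\<in>UNIV. z $ i *\<^sub>C u $ i + cnj (z $ i) *\<^sub>C (u $ i)\<^sup>\<star>)"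

lemma re_sum_star: "(re_sum u z)\<^sup>\<star> = re_sum u z"
  by (simp add: re_sum_def star_scaleC star_sum star_add star_star add.commute)

lemma state_re_sum:
  assumes "state \<phi>"
  shows "\<phi> (re_sum u z) = of_real (Re (\<Sum>i\<in>UNIV. \<phi> (u $ i) * z $ i))"
proof -
  have "\<phi> (re_sum u z) = (\<Sum>i\<in>UNIV. \<phi> (u $ i) * z $ i + cnj (\<phi> (u $ i) * z $ i)) / 2"
    by (simp add: re_sum_def state_scaleC[OF assms] state_sum[OF assms] state_add[OF assms]
        state_star[OF assms] mult.commute)
  then show ?thesis by (simp only: sum_plus_cnj)
qed

definition letter_coeff :: "complex ^ 'n \<Rightarrow> 'n \<times> bool \<Rightarrow> complex" where
  "letter_coeff z a = (if snd a then z $ fst a else cnj (z $ fst a))"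

lemma cmod_letter_coeff [simp]: "cmod (letter_coeff z a) = cmod (z $ fst a)"
  by (simp add: letter_coeff_def)

text \<open>
  A generator maps each word either to a child or to its parent in the tree of reduced words, so
  every edge is traversed exactly once: towards the child or towards the parent according to
  whether the first letter of the child is a generator or an inverse. In the real part both
  directions contribute in the same way, up to conjugating \<open>z\<close>.
\<close>
lemma generators_form:
  fixes u :: "'a::cstar_algebra ^ 'n::finite"
  assumes "state \<tau>" "free_haar_unitaries \<tau> u"
  shows "Re (\<Sum>i\<in>UNIV. \<tau> ((combination u n c)\<^sup>\<star> * u $ i * combination u n c) * z $ i)
    = (\<Sum>w\<in>ball_words n - {[]}. Re (letter_coeff z (hd w) * cnj (c w) * c (tl w)))"
proof -
  let ?g = "\<lambda>w i. of_bool (hd w = (i, True)) * (cnj (c w) * c (tl w))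
          + of_bool (hd w = (i, False)) * (cnj (c (tl w)) * c w)"
  have "(\<Sum>i\<in>UNIV. \<tau> ((combination u n c)\<^sup>\<star> * u $ i * combination u n c) * z $ i)
      = (\<Sum>w\<in>ball_words n - {[]}. \<Sum>i\<in>UNIV. ?g w i * z $ i)"
    unfolding generator_form[OF assms] sum_distrib_right by (rule sum.swap)
  moreover have "Re (\<Sum>i\<in>UNIV. ?g w i * z $ i) = Re (letter_coeff z (hd w) * cnj (c w) * c (tl w))" for w
  proof -
    obtain j s where js: "hd w = (j, s)" by fastforce
    have "(\<Sum>i\<in>UNIV. ?g w i * z $ i) = (\<Sum>i\<in>UNIV. if i = j then ?g w j * z $ j else 0)"
      by (intro sum.cong) (auto simp: js)
    then show ?thesis by (cases s) (auto simp: js letter_coeff_def algebra_simps)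
  qed
  ultimately show ?thesis by simp
qed

lemma combination_re_sum_form:
  fixes u :: "'a::cstar_algebra ^ 'n::finite"
  assumes "state \<tau>" "free_haar_unitaries \<tau> u"
  shows "Re (\<tau> ((combination u n c)\<^sup>\<star> * re_sum u z * combination u n c))
    = (\<Sum>w\<in>ball_words n - {[]}. Re (letter_coeff z (hd w) * cnj (c w) * c (tl w)))"
proof -
  let ?b = "combination u n c"
  have adj: "\<tau> (?b\<^sup>\<star> * (u $ i)\<^sup>\<star> * ?b) = cnj (\<tau> (?b\<^sup>\<star> * u $ i * ?b))" for i
    using state_star[OF assms(1), of "?b\<^sup>\<star> * u $ i * ?b"] by (simp add: star_mult star_star mult.assoc)
  have "\<tau> (?b\<^sup>\<star> * re_sum u z * ?b)
      = (\<Sum>i\<in>UNIV. \<tau> (?b\<^sup>\<star> * u $ i * ?b) * z $ i + cnj (\<tau> (?b\<^sup>\<star> * u $ i * ?b) * z $ i)) / 2"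
    by (simp add: re_sum_def sum_distrib_left sum_distrib_right mult_scaleC_left mult_scaleC_right
        distrib_left distrib_right state_scaleC[OF assms(1)] state_sum[OF assms(1)]
        state_add[OF assms(1)] adj mult.commute)
  also have "\<dots> = of_real (Re (\<Sum>i\<in>UNIV. \<tau> (?b\<^sup>\<star> * u $ i * ?b) * z $ i))"
    by (rule sum_plus_cnj)
  finally show ?thesis using generators_form[OF assms] by simp
qed

section \<open>The space of finite combinations of words\<close>

definition combinations :: "'a::cstar_algebra ^ 'n::finite \<Rightarrow> 'a set" where
  "combinations u = {combination u n c | n c. True}"

lemma combination_extend:
  assumes "n \<le> m"
  shows "combination u n c = combination u m (\<lambda>w. if length w \<le> n then c w else 0)"
  unfolding combination_def
  by (intro sum.mono_neutral_cong_left finite_ball_words) (use assms in \<open>auto simp: ball_words_def\<close>)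

lemma combinations_add: "a \<in> combinations u \<Longrightarrow> b \<in> combinations u \<Longrightarrow> a + b \<in> combinations u"
proof -
  assume "a \<in> combinations u" "b \<in> combinations u"
  then obtain n c m e where ab: "a = combination u n c" "b = combination u m e"
    by (auto simp: combinations_def)
  obtain c' where c': "a = combination u (max n m) c'"
    using combination_extend[of n "max n m" u c] ab by auto
  obtain e' where e': "b = combination u (max n m) e'"
    using combination_extend[of m "max n m" u e] ab by auto
  have "a + b = combination u (max n m) (\<lambda>w. c' w + e' w)"
    by (simp add: c' e' combination_def scaleC_add_left sum.distrib)
  then show ?thesis by (auto simp: combinations_def)
qed

lemma combinations_scaleC: "a \<in> combinations u \<Longrightarrow> r *\<^sub>C a \<in> combinations u"
proof -
  assume "a \<in> combinations u"
  then obtain n c where a: "a = combination u n c" by (auto simp: combinations_def)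
  have "r *\<^sub>C a = combination u n (\<lambda>w. r * c w)"
    by (simp add: a combination_def scaleC_sum_right scaleC_scaleC)
  then show ?thesis by (auto simp: combinations_def)
qed

lemma word_in_combinations: "reduced w \<Longrightarrow> word u w \<in> combinations u"
proof -
  assume "reduced w"
  then have "w \<in> ball_words (length w)" by (simp add: ball_words_def)
  moreover have "combination u (length w) (\<lambda>v. of_bool (v = w))
      = (\<Sum>v\<in>ball_words (length w). if v = w then word u w else 0)"
    unfolding combination_def by (intro sum.cong) auto
  ultimately have "word u w = combination u (length w) (\<lambda>v. of_bool (v = w))" by simp
  then show ?thesis by (auto simp: combinations_def)
qed

lemma one_in_combinations: "1 \<in> combinations u"
  using word_in_combinations[of "[]" u] by simp

lemma combinations_sum: "(\<And>i. i \<in> I \<Longrightarrow> f i \<in> combinations u) \<Longrightarrow> sum f I \<in> combinations u"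
proof (induction I rule: infinite_finite_induct)
  case (insert x F)
  then show ?case by (simp add: combinations_add)
qed (use combinations_scaleC[OF one_in_combinations, of 0] in auto)

lemma letter_times_combinations:
  assumes u: "\<And>i. unitary (u $ i)" and b: "b \<in> combinations u"
  shows "letter u a * b \<in> combinations u"
proof -
  obtain n c where bc: "b = combination u n c" using b by (auto simp: combinations_def)
  have "letter u a * word u w \<in> combinations u" if rw: "reduced w" for w
  proof (cases "reduced (a # w)")
    case True
    then show ?thesis using word_in_combinations[OF True] by (simp add: word_Cons)
  next
    case False
    then obtain w' where w: "w = inv_letter a # w'" using rw False by (cases w) (auto simp: reduced_Cons)
    have "letter u a * word u w = word u w'"
      using letter_cancel[OF u, of "inv_letter a"] by (simp add: w word_Cons flip: mult.assoc)
    then show ?thesis using word_in_combinations[of w' u] rw by (simp add: w reduced_Cons)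
  qed
  then show ?thesis
    unfolding bc combination_def
    by (auto simp: sum_distrib_left mult_scaleC_right ball_words_def
        intro!: combinations_sum combinations_scaleC)
qed

lemma re_sum_times_combinations:
  assumes u: "\<And>i. unitary (u $ i)" and b: "b \<in> combinations u"
  shows "re_sum u z * b \<in> combinations u"
proof -
  have "u $ i * b \<in> combinations u" "(u $ i)\<^sup>\<star> * b \<in> combinations u" for i
    using letter_times_combinations[OF u b, of "(i, True)"] letter_times_combinations[OF u b, of "(i, False)"]
    by (simp_all add: letter_def)
  then show ?thesis
    by (auto simp: re_sum_def mult_scaleC_left sum_distrib_right distrib_right
        intro!: combinations_sum combinations_scaleC combinations_add)
qed

section \<open>The level function\<close>

definition level :: "real \<Rightarrow> real ^ 'n::finite \<Rightarrow> real" where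
  "level t x = (\<Sum>i\<in>UNIV. sqrt (t\<^sup>2 + (x $ i)\<^sup>2)) - (real CARD('n) - 1) * t"

text \<open>
  The share of an edge that is charged to the parent. The child is charged \<open>edge_weight t x + 2 * t\<close>;
  the excess \<open>2 * t\<close> does not depend on the type of the edge, which makes the charges of all
  vertices except the root equal.
\<close>
definition edge_weight :: "real \<Rightarrow> real \<Rightarrow> real" where
  "edge_weight t x = sqrt (t\<^sup>2 + x\<^sup>2) - t"

lemma level_edge_weight: "level t x = (\<Sum>i\<in>UNIV. edge_weight t (x $ i)) + t"
  by (simp add: level_def edge_weight_def sum_subtractf algebra_simps)

lemma edge_weight_nonneg: "t \<ge> 0 \<Longrightarrow> edge_weight t x \<ge> 0"
  by (simp add: edge_weight_def real_le_rsqrt)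

lemma edge_weight_zero: "t \<ge> 0 \<Longrightarrow> edge_weight t 0 = 0"
  by (simp add: edge_weight_def)

lemma edge_weight_mult: "edge_weight t x * (edge_weight t x + 2 * t) = x\<^sup>2"
proof -
  have "(sqrt (t\<^sup>2 + x\<^sup>2))\<^sup>2 = t\<^sup>2 + x\<^sup>2" by simp
  then show ?thesis by (simp add: edge_weight_def algebra_simps power2_eq_square)
qed

lemma edge_weight_amgm:
  assumes "t \<ge> 0"
  shows "2 * (\<bar>x\<bar> * a * b) \<le> edge_weight t x * a\<^sup>2 + (edge_weight t x + 2 * t) * b\<^sup>2"
proof -
  let ?p = "edge_weight t x"
  have p: "?p \<ge> 0" using edge_weight_nonneg[OF assms] .
  have x: "\<bar>x\<bar> = sqrt ?p * sqrt (?p + 2 * t)"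
    by (simp add: real_sqrt_mult[symmetric] edge_weight_mult)
  have "0 \<le> (sqrt ?p * a - sqrt (?p + 2 * t) * b)\<^sup>2" by simp
  also have "\<dots> = ?p * a\<^sup>2 + (?p + 2 * t) * b\<^sup>2 - 2 * (\<bar>x\<bar> * a * b)"
    unfolding x using p assms by (simp add: power2_diff power_mult_distrib)
  finally show ?thesis by simp
qed

lemma level_ge_coordinate:
  fixes x :: "real ^ 'n::finite"
  assumes "t \<ge> 0"
  shows "\<bar>x $ i\<bar> \<le> level t x"
proof -
  have "edge_weight t (x $ i) \<le> (\<Sum>j\<in>UNIV. edge_weight t (x $ j))"
    by (rule member_le_sum) (auto simp: edge_weight_nonneg assms)
  moreover have "\<bar>x $ i\<bar> \<le> sqrt (t\<^sup>2 + (x $ i)\<^sup>2)" by (rule real_le_rsqrt) simp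
  then have "\<bar>x $ i\<bar> \<le> edge_weight t (x $ i) + t" by (simp add: edge_weight_def)
  ultimately show ?thesis by (simp add: level_edge_weight)
qed

lemma level_add_le:
  fixes x :: "real ^ 'n::finite"
  assumes "t \<ge> 0" "e \<ge> 0"
  shows "level (t + e) x \<le> level t x + e"
proof -
  have "sqrt ((t + e)\<^sup>2 + (x $ i)\<^sup>2) \<le> sqrt (t\<^sup>2 + (x $ i)\<^sup>2) + e" for i
  proof (rule real_le_lsqrt)
    have "t \<le> sqrt (t\<^sup>2 + (x $ i)\<^sup>2)" by (rule real_le_rsqrt) simp
    then have "t * e \<le> sqrt (t\<^sup>2 + (x $ i)\<^sup>2) * e" using assms(2) by (rule mult_right_mono)
    then show "(t + e)\<^sup>2 + (x $ i)\<^sup>2 \<le> (sqrt (t\<^sup>2 + (x $ i)\<^sup>2) + e)\<^sup>2"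
      by (simp add: power2_sum)
  qed (use assms in auto)
  then have "(\<Sum>i\<in>UNIV. sqrt ((t + e)\<^sup>2 + (x $ i)\<^sup>2)) \<le> (\<Sum>i\<in>UNIV. sqrt (t\<^sup>2 + (x $ i)\<^sup>2) + e)"
    by (rule sum_mono)
  then show ?thesis by (simp add: level_def sum.distrib algebra_simps)
qed

lemma level_scale:
  fixes x :: "real ^ 'n::finite"
  assumes "r \<ge> 0"
  shows "level (r * t) (r *\<^sub>R x) = r * level t x"
proof -
  have "sqrt ((r * t)\<^sup>2 + (r * x $ i)\<^sup>2) = r * sqrt (t\<^sup>2 + (x $ i)\<^sup>2)" for i
  proof -
    have "(r * t)\<^sup>2 + (r * x $ i)\<^sup>2 = r\<^sup>2 * (t\<^sup>2 + (x $ i)\<^sup>2)" by (simp add: power_mult_distrib distrib_left)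
    then show ?thesis using assms by (simp add: real_sqrt_mult)
  qed
  then show ?thesis by (simp add: level_def sum_distrib_left algebra_simps)
qed

text \<open>
  The margin \<open>e\<close> accounts for an infimum that is only approached, as happens for \<open>t\<close> tending to \<open>0\<close>
  when \<open>x\<close> has a single nonzero coordinate.
\<close>
lemma E_set_iff: "x \<in> E_set \<longleftrightarrow> (\<forall>e>0. \<exists>t>0. level t x \<le> 1 + e)"
proof -
  have abs: "\<bar>level t x\<bar> = level t x" if "t > 0" for t
    using level_ge_coordinate[of t x undefined] that by linarith
  have "x \<in> E_set \<longleftrightarrow> (INF t\<in>{0<..}. level t x) \<le> 1"
    unfolding E_set_def level_def[symmetric] mem_Collect_eq
    by (intro arg_cong[where f = "\<lambda>y. y \<le> 1"] INF_cong) (auto simp: abs)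
  also have "\<dots> \<longleftrightarrow> (\<forall>e>0. \<exists>t>0. level t x \<le> 1 + e)"
  proof
    have bdd: "bdd_below ((\<lambda>t. level t x) ` {0<..})"
      by (rule bdd_belowI2[of _ 0]) (use abs in \<open>metis abs_ge_zero greaterThan_iff\<close>)
    show "(INF t\<in>{0<..}. level t x) \<le> 1" if *: "\<forall>e>0. \<exists>t>0. level t x \<le> 1 + e"
    proof (rule field_le_epsilon)
      fix e :: real assume "e > 0"
      then obtain t where "t > 0" "level t x \<le> 1 + e" using * by blast
      then show "(INF t\<in>{0<..}. level t x) \<le> 1 + e" using bdd by (intro cINF_lower2[where x = t]) auto
    qed
    show "\<forall>e>0. \<exists>t>0. level t x \<le> 1 + e" if *: "(INF t\<in>{0<..}. level t x) \<le> 1"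
    proof (intro allI impI)
      fix e :: real assume "e > 0"
      then have "(INF t\<in>{0<..}. level t x) < 1 + e" using * by simp
      then obtain t where "t \<in> {0<..}" "level t x < 1 + e"
        using cINF_less_iff[OF _ bdd] by auto
      then show "\<exists>t>0. level t x \<le> 1 + e" by (auto intro: less_imp_le)
    qed
  qed
  finally show ?thesis .
qed

text \<open>
  The equation for \<open>t\<close> is the criticality condition for \<open>level\<close>, with the derivative of \<open>sqrt (t\<^sup>2 + x\<^sup>2)\<close> at
  \<open>x = 0\<close> read as \<open>1\<close> also at \<open>t = 0\<close>. With this reading the infimum that is attained at the
  boundary point \<open>t = 0\<close> (one nonzero coordinate) needs no separate treatment.
\<close>
lemma critical_point_exists:
  fixes x :: "real ^ 'n::finite"
  assumes "x \<noteq> 0"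
  obtains t where "t \<ge> 0" "(\<Sum>i\<in>UNIV. if x $ i = 0 then 0 else 1 - t / sqrt (t\<^sup>2 + (x $ i)\<^sup>2)) = 1"
proof -
  define G where "G t = (\<Sum>i\<in>UNIV. if x $ i = 0 then 0 else 1 - t / sqrt (t\<^sup>2 + (x $ i)\<^sup>2))" for t
  \<comment> \<open>Each summand of \<open>G t\<close> is at most \<open>\<bar>x $ i\<bar> / t\<close>, so \<open>G\<close> has dropped to at most \<open>1\<close> at this point.\<close>
  define T where "T = (\<Sum>i\<in>UNIV. \<bar>x $ i\<bar>)"
  obtain j where j: "x $ j \<noteq> 0" using assms by (auto simp: vec_eq_iff)
  have "\<bar>x $ j\<bar> \<le> T" unfolding T_def by (rule member_le_sum) auto
  then have T: "T > 0" using j by linarith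
  have "(if x $ j = 0 then 0 else (1::real)) \<le> (\<Sum>i\<in>UNIV. if x $ i = 0 then 0 else 1)"
    by (rule member_le_sum) auto
  then have G0: "G 0 \<ge> 1" using j by (simp add: G_def cong: if_cong)
  have "G T \<le> (\<Sum>i\<in>UNIV. \<bar>x $ i\<bar> / T)"
    unfolding G_def
  proof (rule sum_mono)
    fix i
    let ?s = "sqrt (T\<^sup>2 + (x $ i)\<^sup>2)"
    have s: "?s \<ge> T" by (rule real_le_rsqrt) simp
    then have "?s * T > 0" using T by (intro mult_pos_pos) linarith+
    have "?s \<le> T + \<bar>x $ i\<bar>" by (rule real_le_lsqrt) (use T in \<open>auto simp: power2_sum\<close>)
    then have "(?s - T) / ?s \<le> \<bar>x $ i\<bar> / ?s" using s T by (intro divide_right_mono) auto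
    then have "1 - T / ?s \<le> \<bar>x $ i\<bar> / ?s" using s T by (simp add: diff_divide_distrib)
    also have "\<dots> \<le> \<bar>x $ i\<bar> / T" using s \<open>?s * T > 0\<close> by (intro divide_left_mono) auto
    finally show "(if x $ i = 0 then 0 else 1 - T / ?s) \<le> \<bar>x $ i\<bar> / T" using T by simp
  qed
  also have "\<dots> = 1" using T by (simp add: sum_divide_distrib[symmetric] T_def[symmetric])
  finally have GT: "G T \<le> 1" .
  have "continuous_on {0..T} (\<lambda>t. if x $ i = 0 then 0 else 1 - t / sqrt (t\<^sup>2 + (x $ i)\<^sup>2))" for i
    by (cases "x $ i = 0") (auto intro!: continuous_intros simp: add_nonneg_eq_0_iff)
  then have "continuous_on {0..T} G" unfolding G_def by (intro continuous_on_sum) auto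
  then obtain t where "0 \<le> t" "t \<le> T" "G t = 1"
    using IVT2'[of G T 1 0] G0 GT T by auto
  then show thesis using that by (auto simp: G_def)
qed

section \<open>The upper bound for all states\<close>

text \<open>
  Every edge is charged to its two ends. A vertex other than the root pays for all its children,
  where the letter inverse to its own first letter is missing, and for the edge
  to its parent; the two occurrences of its own weight cancel.
\<close>
lemma re_sum_form_le_level:
  fixes u :: "'a::cstar_algebra ^ 'n::finite" and z :: "complex ^ 'n"
  assumes "state \<tau>" "free_haar_unitaries \<tau> u" "t \<ge> 0"
  shows "Re (\<tau> ((combination u n c)\<^sup>\<star> * re_sum u z * combination u n c))
    \<le> level t (\<chi> i. cmod (z $ i)) * (\<Sum>w\<in>ball_words n. (cmod (c w))\<^sup>2)"
proof -
  let ?B = "ball_words n :: ('n \<times> bool) list set"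
  define p where "p i = edge_weight t (cmod (z $ i))" for i
  define P where "P = (\<Sum>i\<in>UNIV. p i)"
  have p0: "p i \<ge> 0" for i unfolding p_def by (rule edge_weight_nonneg[OF assms(3)])
  have edge: "2 * Re (letter_coeff z (hd w) * cnj (c w) * c (tl w))
      \<le> p (fst (hd w)) * (cmod (c (tl w)))\<^sup>2 + (p (fst (hd w)) + 2 * t) * (cmod (c w))\<^sup>2" for w
  proof -
    have "Re (letter_coeff z (hd w) * cnj (c w) * c (tl w))
        \<le> cmod (letter_coeff z (hd w) * cnj (c w) * c (tl w))" by (rule complex_Re_le_cmod)
    also have "\<dots> = \<bar>cmod (z $ fst (hd w))\<bar> * cmod (c (tl w)) * cmod (c w)"
      by (simp add: norm_mult)
    finally show ?thesis using edge_weight_amgm[OF assms(3), of "cmod (z $ fst (hd w))" "cmod (c (tl w))" "cmod (c w)"]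
      by (simp add: p_def)
  qed
  have parents: "(\<Sum>w\<in>?B - {[]}. p (fst (hd w)) * (cmod (c (tl w)))\<^sup>2)
      \<le> (\<Sum>v\<in>?B. (2 * P - (if v = [] then 0 else p (fst (hd v)))) * (cmod (c v))\<^sup>2)"
  proof -
    have "(\<Sum>w\<in>?B - {[]}. p (fst (hd w)) * (cmod (c (tl w)))\<^sup>2)
        \<le> (\<Sum>w\<in>ball_words (Suc n) - {[]}. p (fst (hd w)) * (cmod (c (tl w)))\<^sup>2)"
      by (rule sum_mono2) (auto simp: p0 intro!: finite_Diff finite_ball_words, auto simp: ball_words_def)
    also have "\<dots> = (\<Sum>v\<in>?B. (\<Sum>a\<in>children v. p (fst a)) * (cmod (c v))\<^sup>2)"
      by (simp add: sum_ball_words_children sum_distrib_right)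
    also have "\<dots> = (\<Sum>v\<in>?B. (2 * P - (if v = [] then 0 else p (fst (hd v)))) * (cmod (c v))\<^sup>2)"
      by (intro sum.cong refl) (simp add: ball_words_def sum_children P_def)
    finally show ?thesis .
  qed
  have "2 * (\<Sum>w\<in>?B - {[]}. Re (letter_coeff z (hd w) * cnj (c w) * c (tl w)))
      \<le> (\<Sum>w\<in>?B - {[]}. p (fst (hd w)) * (cmod (c (tl w)))\<^sup>2)
        + (\<Sum>w\<in>?B - {[]}. (p (fst (hd w)) + 2 * t) * (cmod (c w))\<^sup>2)"
    unfolding sum_distrib_left sum.distrib[symmetric] by (rule sum_mono) (rule edge)
  also have "(\<Sum>w\<in>?B - {[]}. (p (fst (hd w)) + 2 * t) * (cmod (c w))\<^sup>2)
      = (\<Sum>w\<in>?B. (if w = [] then 0 else p (fst (hd w)) + 2 * t) * (cmod (c w))\<^sup>2)"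
    by (rule sum.mono_neutral_cong_left) auto
  also note parents
  also have "(\<Sum>v\<in>?B. (2 * P - (if v = [] then 0 else p (fst (hd v)))) * (cmod (c v))\<^sup>2)
      + (\<Sum>v\<in>?B. (if v = [] then 0 else p (fst (hd v)) + 2 * t) * (cmod (c v))\<^sup>2)
      \<le> (\<Sum>v\<in>?B. 2 * (P + t) * (cmod (c v))\<^sup>2)"
    unfolding sum.distrib[symmetric] distrib_right[symmetric]
    by (intro sum_mono mult_right_mono) (use assms(3) in auto)
  also have "\<dots> = 2 * ((P + t) * (\<Sum>v\<in>?B. (cmod (c v))\<^sup>2))"
    by (simp only: sum_distrib_left mult.assoc)
  finally show ?thesis
    using combination_re_sum_form[OF assms(1,2)] by (simp add: level_edge_weight P_def p_def)
qed

text \<open>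
  For an arbitrary state the bound follows from positivity of \<open>level t x - h\<close>, tested only on the
  combinations of words. They form a subspace that is invariant under left multiplication by \<open>h\<close>.
\<close>
lemma state_re_le_level:
  fixes u :: "'a::cstar_algebra ^ 'n::finite" and z :: "complex ^ 'n"
  assumes "cstar_probability_space \<tau>" "free_haar_unitaries \<tau> u" "state \<phi>" "t \<ge> 0"
  shows "Re (\<Sum>i\<in>UNIV. \<phi> (u $ i) * z $ i) \<le> level t (\<chi> i. cmod (z $ i))"
proof -
  let ?l = "level t (\<chi> i. cmod (z $ i))"
  define k where "k = ?l *\<^sub>R 1 - re_sum u z"
  have st: "state \<tau>" using assms(1) by (simp add: cstar_probability_space_def)
  have un: "unitary (u $ i)" for i using assms(2) by (simp add: free_haar_unitaries_def)
  have scaleR_V: "r *\<^sub>R b \<in> combinations u" if "b \<in> combinations u" for b and r :: real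
    using combinations_scaleC[OF that, of "of_real r"] by (simp add: scaleC_of_real)
  have "Re (\<phi> k) \<ge> 0"
  proof (rule faithful_state_detects_positivity[OF assms(1,3)])
    show "k\<^sup>\<star> = k" by (simp add: k_def star_diff star_scaleR re_sum_star)
    show "1 \<in> combinations u" by (rule one_in_combinations)
    show "a + b \<in> combinations u" if "a \<in> combinations u" "b \<in> combinations u" for a b
      using that by (rule combinations_add)
    show "r *\<^sub>R b \<in> combinations u" if "b \<in> combinations u" for b and r :: real
      using that by (rule scaleR_V)
    show "k * b \<in> combinations u" if b: "b \<in> combinations u" for b
    proof -
      have "k * b = ?l *\<^sub>R b + (- 1) *\<^sub>R (re_sum u z * b)" by (simp add: k_def left_diff_distrib)
      then show ?thesis
        by (simp only:) (intro combinations_add scaleR_V b re_sum_times_combinations un)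
    qed
    show "Re (\<tau> (b\<^sup>\<star> * k * b)) \<ge> 0" if bV: "b \<in> combinations u" for b
    proof -
      obtain n c where b: "b = combination u n c" using bV by (auto simp: combinations_def)
      have "b\<^sup>\<star> * k * b = ?l *\<^sub>R (b\<^sup>\<star> * b) - b\<^sup>\<star> * re_sum u z * b"
        by (simp add: k_def left_diff_distrib right_diff_distrib)
      then have "Re (\<tau> (b\<^sup>\<star> * k * b)) = ?l * (\<Sum>w\<in>ball_words n. (cmod (c w))\<^sup>2) - Re (\<tau> (b\<^sup>\<star> * re_sum u z * b))"
        by (simp add: state_diff[OF st] state_scaleR[OF st] b combination_norm[OF st assms(2)])
      then show ?thesis using re_sum_form_le_level[OF st assms(2,4), of n c z] b by simp
    qed
  qed
  then show ?thesis
    by (simp add: k_def state_diff[OF assms(3)] state_scaleR[OF assms(3)] state_one[OF assms(3)]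
        state_re_sum[OF assms(3)])
qed

section \<open>Vector states that attain the bound\<close>

lemma vector_state:
  fixes b :: "'a::cstar_algebra"
  assumes "state \<tau>" "\<tau> (b\<^sup>\<star> * b) = of_real N" "N > 0"
  shows "state (\<lambda>a. \<tau> (b\<^sup>\<star> * a * b) / of_real N)"
proof -
  have "\<tau> (b\<^sup>\<star> * (a\<^sup>\<star> * a) * b) / of_real N \<in> \<real>\<^sub>\<ge>\<^sub>0" for a
  proof -
    have "\<tau> ((a * b)\<^sup>\<star> * (a * b)) \<in> \<real>\<^sub>\<ge>\<^sub>0" by (rule state_pos[OF assms(1)])
    then show ?thesis using assms(3)
      by (simp add: star_mult mult.assoc complex_nonneg_Reals_iff)
  qed
  then show ?thesis
    using assms(2,3)
    by (auto simp: state_def distrib_left distrib_right state_add[OF assms(1)] add_divide_distrib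
        mult_scaleC_left mult_scaleC_right state_scaleC[OF assms(1)])
qed

text \<open>
  The vector \<open>c w = \<Prod>a\<in>w. \<gamma> a\<close> turns the arithmetic-geometric inequality into an equality on every edge.
  With \<open>q = \<bar>\<gamma>\<bar>\<^sup>2\<close>, the criticality of \<open>t\<close> says exactly that \<open>\<bar>c\<bar>\<^sup>2\<close>, weighted by \<open>1 / (1 + q)\<close> at the first
  letter, has the same total mass on every sphere of positive radius. Hence truncating \<open>c\<close> to a
  large ball loses only a bounded amount of a total that grows linearly in the radius.
\<close>
lemma critical_level_le_of_states:
  fixes u :: "'a::cstar_algebra ^ 'n::finite" and z :: "complex ^ 'n"
  assumes "state \<tau>" "free_haar_unitaries \<tau> u" "t \<ge> 0"
    and crit: "(\<Sum>i\<in>UNIV. if z $ i = 0 then 0 else 1 - t / sqrt (t\<^sup>2 + (cmod (z $ i))\<^sup>2)) = 1"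
    and beta: "\<And>\<phi>. state \<phi> \<Longrightarrow> Re (\<Sum>i\<in>UNIV. \<phi> (u $ i) * z $ i) \<le> \<beta>"
  shows "level t (\<chi> i. cmod (z $ i)) \<le> \<beta>"
proof -
  define p where "p i = edge_weight t (cmod (z $ i))" for i
  define P where "P = (\<Sum>i\<in>UNIV. p i)"
  have p0: "p i \<ge> 0" for i unfolding p_def by (rule edge_weight_nonneg[OF assms(3)])
  have pz: "p i = 0" if "z $ i = 0" for i unfolding p_def using that edge_weight_zero[OF assms(3)] by simp
  have pm: "p i * (p i + 2 * t) = (cmod (z $ i))\<^sup>2" for i unfolding p_def by (rule edge_weight_mult)
  \<comment> \<open>Where \<open>z\<close> vanishes, the quotient is \<open>0\<close>, so that \<open>c\<close> lives on words in the other letters.\<close>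
  define \<gamma> where "\<gamma> a = of_real (p (fst a)) / cnj (letter_coeff z a)" for a
  define q where "q i = (p i / cmod (z $ i))\<^sup>2" for i
  have gq: "(cmod (\<gamma> a))\<^sup>2 = q (fst a)" for a
    using p0 by (simp add: \<gamma>_def q_def norm_divide)
  have gp: "letter_coeff z a * cnj (\<gamma> a) = of_real (p (fst a))" for a
  proof (cases "z $ fst a = 0")
    case False
    then have "letter_coeff z a \<noteq> 0" by (simp add: letter_coeff_def)
    then show ?thesis by (simp add: \<gamma>_def)
  qed (simp add: pz letter_coeff_def)
  have q0: "q i \<ge> 0" for i by (simp add: q_def)
  have qp: "(p i + 2 * t) * q i = p i" for i
  proof (cases "z $ i = 0")
    case False
    have "(p i + 2 * t) * q i = p i * (p i * (p i + 2 * t)) / (cmod (z $ i))\<^sup>2"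
      by (simp add: q_def power2_eq_square)
    then show ?thesis using False by (simp add: pm)
  qed (simp add: pz q_def)
  have q1: "q i \<le> 1" for i
  proof (cases "p i = 0")
    case False
    then have "(p i + 2 * t) * q i \<le> (p i + 2 * t) * 1" using qp[of i] assms(3) by simp
    then show ?thesis using False p0[of i] assms(3) by (simp add: mult_le_cancel_left)
  qed (simp add: q_def)
  \<comment> \<open>A child by a letter of type \<open>i\<close> has \<open>r i\<close> times the mass of its parent, once the mass is weighted
    by \<open>1 / (1 + q)\<close>. Criticality of \<open>t\<close> makes these ratios sum to \<open>1\<close> over all letters, inverses included.\<close>
  define r where "r i = q i / (1 + q i)" for i
  have r: "1 - r i = 1 / (1 + q i)" for i
    using q0[of i] by (simp add: r_def field_simps)
  have "2 * r i = (if z $ i = 0 then 0 else 1 - t / sqrt (t\<^sup>2 + (cmod (z $ i))\<^sup>2))" for i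
  proof (cases "z $ i = 0")
    case False
    define s where "s = sqrt (t\<^sup>2 + (cmod (z $ i))\<^sup>2)"
    have s: "s > 0" using False by (simp add: s_def add_nonneg_pos)
    have ps: "p i = s - t" by (simp add: p_def edge_weight_def s_def)
    have "(s + t) * q i = s - t" using qp[of i] by (simp add: ps algebra_simps)
    then have "(2 * q i) * s = (s - t) * (1 + q i)" by (simp add: algebra_simps)
    moreover have "1 + q i \<noteq> 0" using q0[of i] by linarith
    ultimately have "2 * q i / (1 + q i) = (s - t) / s" using s by (subst frac_eq_eq) auto
    then have "2 * r i = (s - t) / s" by (simp add: r_def)
    then show ?thesis using s False by (simp add: diff_divide_distrib s_def)
  qed (simp add: r_def q_def)
  then have rsum: "2 * (\<Sum>i\<in>UNIV. r i) = 1" using crit by (simp add: sum_distrib_left)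

  define c where "c w = prod_list (map \<gamma> w)" for w
  have c_Cons: "c (a # v) = \<gamma> a * c v" and c_Nil: "c [] = 1" for a v by (simp_all add: c_def)
  define m where "m w = (cmod (c w))\<^sup>2" for w
  have m_Cons: "m (a # v) = q (fst a) * m v" and m_Nil: "m [] = 1" for a v
    by (simp_all add: m_def c_Cons c_Nil norm_mult power_mult_distrib gq)
  have m0: "m w \<ge> 0" for w by (simp add: m_def)

  have conserved: "(\<Sum>w\<in>sphere_words (Suc n). m w / (1 + q (fst (hd w)))) = 1" for n
  proof (induction n)
    case 0
    have "(\<Sum>w\<in>sphere_words (Suc 0). m w / (1 + q (fst (hd w)))) = (\<Sum>a\<in>children []. r (fst a))"
      by (simp add: sum_sphere_words_children m_Cons m_Nil r_def)
    then show ?case using rsum by (simp add: sum_children)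
  next
    case (Suc n)
    have "(\<Sum>w\<in>sphere_words (Suc (Suc n)). m w / (1 + q (fst (hd w))))
        = (\<Sum>v\<in>sphere_words (Suc n). m v * (\<Sum>a\<in>children v. r (fst a)))"
      by (subst sum_sphere_words_children) (simp add: m_Cons r_def sum_distrib_left mult.commute)
    also have "\<dots> = (\<Sum>v\<in>sphere_words (Suc n). m v / (1 + q (fst (hd v))))"
    proof (rule sum.cong[OF refl])
      fix v :: "('n \<times> bool) list" assume "v \<in> sphere_words (Suc n)"
      then have "reduced v" "v \<noteq> []" by (auto simp: sphere_words_def)
      then have "(\<Sum>a\<in>children v. r (fst a)) = 1 - r (fst (hd v))" using rsum by (simp add: sum_children)
      then show "m v * (\<Sum>a\<in>children v. r (fst a)) = m v / (1 + q (fst (hd v)))" by (simp add: r)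
    qed
    finally show ?case using Suc by simp
  qed
  define M where "M n = (\<Sum>w\<in>sphere_words n. m w)" for n
  have M1: "M (Suc n) \<ge> 1" for n
  proof -
    have "m w / (1 + q (fst (hd w))) \<le> m w" for w
      using divide_left_mono[of 1 "1 + q (fst (hd w))" "m w"] m0[of w] q0[of "fst (hd w)"] by simp
    then have "(\<Sum>w\<in>sphere_words (Suc n). m w / (1 + q (fst (hd w)))) \<le> M (Suc n)"
      unfolding M_def by (rule sum_mono)
    then show ?thesis by (simp only: conserved)
  qed
  have M2: "M (Suc n) \<le> 2" for n
  proof -
    have "M (Suc n) \<le> (\<Sum>w\<in>sphere_words (Suc n). 2 * (m w / (1 + q (fst (hd w)))))"
      unfolding M_def
    proof (rule sum_mono)
      fix w :: "('n \<times> bool) list"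
      have "m w * (1 + q (fst (hd w))) \<le> m w * 2" using q1 m0 by (intro mult_left_mono) auto
      then show "m w \<le> 2 * (m w / (1 + q (fst (hd w))))"
        using q0[of "fst (hd w)"] by (simp add: field_simps)
    qed
    then show ?thesis by (simp only: sum_distrib_left[symmetric] conserved)
  qed
  define N where "N n = (\<Sum>w\<in>ball_words n. m w)" for n
  have N_Suc: "N (Suc n) = N n + M (Suc n)" for n
    by (simp add: N_def M_def sum_ball_words_Suc)
  have N_ge: "N n \<ge> real n + 1" for n
  proof (induction n)
    case (Suc n)
    then show ?case using N_Suc[of n] M1[of n] by simp
  qed (simp add: N_def m_Nil)

  define F where "F n = (\<Sum>w\<in>ball_words n - {[]}. p (fst (hd w)) * m (tl w))" for n
  have F_le: "F n \<le> \<beta> * N n" for n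
  proof -
    let ?b = "combination u n c"
    have Npos: "N n > 0" using N_ge[of n] by linarith
    have "\<tau> (?b\<^sup>\<star> * ?b) = of_real (N n)"
      by (simp add: combination_norm[OF assms(1,2)] N_def m_def)
    from beta[OF vector_state[OF assms(1) this Npos]]
    have "Re (\<Sum>i\<in>UNIV. \<tau> (?b\<^sup>\<star> * u $ i * ?b) / of_real (N n) * z $ i) \<le> \<beta>" .
    also have "(\<Sum>i\<in>UNIV. \<tau> (?b\<^sup>\<star> * u $ i * ?b) / of_real (N n) * z $ i)
        = (\<Sum>i\<in>UNIV. \<tau> (?b\<^sup>\<star> * u $ i * ?b) * z $ i) / of_real (N n)"
      by (simp add: sum_divide_distrib)
    also have "Re \<dots> = (\<Sum>w\<in>ball_words n - {[]}. Re (letter_coeff z (hd w) * cnj (c w) * c (tl w))) / N n"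
      by (simp only: Re_divide_of_real generators_form[OF assms(1,2)])
    also have "(\<Sum>w\<in>ball_words n - {[]}. Re (letter_coeff z (hd w) * cnj (c w) * c (tl w))) = F n"
      unfolding F_def
    proof (rule sum.cong[OF refl])
      fix w :: "('n \<times> bool) list" assume "w \<in> ball_words n - {[]}"
      then obtain a v where w: "w = a # v" by (cases w) auto
      have "letter_coeff z a * cnj (c w) * c v = (letter_coeff z a * cnj (\<gamma> a)) * (c v * cnj (c v))"
        by (simp add: w c_Cons)
      also have "\<dots> = of_real (p (fst a) * m v)"
        by (simp only: gp m_def complex_norm_square[symmetric] of_real_mult of_real_power)
      finally show "Re (letter_coeff z (hd w) * cnj (c w) * c (tl w)) = p (fst (hd w)) * m (tl w)"
        by (simp add: w)
    qed
    finally show ?thesis using Npos by (simp add: divide_le_eq)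
  qed
  \<comment> \<open>By equality on the edges, \<open>F\<close> can be charged entirely to the parents or entirely to the children;
    the bound is the average of both. The root has no parent, which costs \<open>t\<close>.\<close>
  have F_ge: "F (Suc n) \<ge> (P + t) * N n - t" for n
  proof -
    let ?B = "ball_words n :: ('n \<times> bool) list set"
    have out: "F (Suc n) = (\<Sum>v\<in>?B. (2 * P - (if v = [] then 0 else p (fst (hd v)))) * m v)"
    proof -
      have "F (Suc n) = (\<Sum>v\<in>?B. (\<Sum>a\<in>children v. p (fst a)) * m v)"
        by (simp add: F_def sum_ball_words_children sum_distrib_right)
      also have "\<dots> = (\<Sum>v\<in>?B. (2 * P - (if v = [] then 0 else p (fst (hd v)))) * m v)"
        by (intro sum.cong refl) (simp add: ball_words_def sum_children P_def)
      finally show ?thesis .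
    qed
    have "F (Suc n) = (\<Sum>w\<in>ball_words (Suc n) - {[]}. (p (fst (hd w)) + 2 * t) * m w)"
      unfolding F_def
    proof (rule sum.cong[OF refl])
      fix w :: "('n \<times> bool) list" assume "w \<in> ball_words (Suc n) - {[]}"
      then obtain a v where w: "w = a # v" by (cases w) auto
      show "p (fst (hd w)) * m (tl w) = (p (fst (hd w)) + 2 * t) * m w"
        by (simp only: w m_Cons list.sel mult.assoc[symmetric] qp)
    qed
    also have "\<dots> \<ge> (\<Sum>w\<in>?B - {[]}. (p (fst (hd w)) + 2 * t) * m w)"
      by (rule sum_mono2) (use p0 m0 assms(3) in \<open>auto intro!: finite_Diff finite_ball_words mult_nonneg_nonneg add_nonneg_nonneg\<close>, auto simp: ball_words_def)
    also have "(\<Sum>w\<in>?B - {[]}. (p (fst (hd w)) + 2 * t) * m w)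
        = (\<Sum>w\<in>?B. (if w = [] then 0 else p (fst (hd w)) + 2 * t) * m w)"
      by (rule sum.mono_neutral_cong_left) auto
    finally have "2 * F (Suc n) \<ge> (\<Sum>v\<in>?B. (2 * P - (if v = [] then 0 else p (fst (hd v)))) * m v)
        + (\<Sum>w\<in>?B. (if w = [] then 0 else p (fst (hd w)) + 2 * t) * m w)"
      using out by simp
    also have "(\<Sum>v\<in>?B. (2 * P - (if v = [] then 0 else p (fst (hd v)))) * m v)
        + (\<Sum>w\<in>?B. (if w = [] then 0 else p (fst (hd w)) + 2 * t) * m w)
        = (\<Sum>v\<in>?B. 2 * (P + t) * m v - (if v = [] then 2 * t else 0))"
      unfolding sum.distrib[symmetric] by (intro sum.cong refl) (auto simp: algebra_simps m_Nil)
    also have "\<dots> = 2 * ((P + t) * N n - t)"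
      by (simp add: sum_subtractf sum_distrib_left[symmetric] N_def)
    finally show ?thesis by simp
  qed
  have beta0: "\<beta> \<ge> 0"
  proof -
    have "0 \<le> F 0" by (simp add: F_def)
    also have "\<dots> \<le> \<beta> * N 0" by (rule F_le)
    finally show ?thesis by (simp add: N_def m_Nil)
  qed
  have bound: "(P + t - \<beta>) * N n \<le> 2 * \<beta> + t" for n
  proof -
    have "(P + t) * N n - t \<le> \<beta> * (N n + M (Suc n))"
      using F_ge[of n] F_le[of "Suc n"] N_Suc[of n] by simp
    also have "\<dots> \<le> \<beta> * (N n + 2)" using beta0 M2[of n] by (intro mult_left_mono) auto
    finally show ?thesis by (simp add: algebra_simps)
  qed
  have "P + t \<le> \<beta>"
  proof (rule ccontr)
    assume "\<not> P + t \<le> \<beta>"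
    then have pos: "P + t - \<beta> > 0" by simp
    obtain n :: nat where "real n > (2 * \<beta> + t) / (P + t - \<beta>)" using reals_Archimedean2 by blast
    then have "N n > (2 * \<beta> + t) / (P + t - \<beta>)" using N_ge[of n] by linarith
    then have "(P + t - \<beta>) * N n > 2 * \<beta> + t" using pos by (simp add: divide_less_eq mult.commute)
    then show False using bound[of n] by linarith
  qed
  then show ?thesis by (simp add: level_edge_weight P_def p_def)
qed

section \<open>The numerical range is convex and compact\<close>

lemma convex_numerical_range: "convex (numerical_range (A :: 'a::cstar_algebra ^ 'n::finite))"
proof (rule convexI)
  fix v w :: "complex ^ 'n" and r s :: real
  assume "v \<in> numerical_range A" "w \<in> numerical_range A" and rs: "0 \<le> r" "0 \<le> s" "r + s = 1"
  then obtain \<phi> \<psi> where st: "state \<phi>" "state \<psi>" and vw: "v = (\<chi> i. \<phi> (A $ i))" "w = (\<chi> i. \<psi> (A $ i))"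
    by (auto simp: numerical_range_def)
  define \<chi>' where "\<chi>' a = of_real r * \<phi> a + of_real s * \<psi> a" for a
  have "state \<chi>'"
    unfolding state_def
  proof (intro conjI allI)
    show "\<chi>' (a\<^sup>\<star> * a) \<in> \<real>\<^sub>\<ge>\<^sub>0" for a
      using state_pos[OF st(1), of a] state_pos[OF st(2), of a] rs
      by (simp add: complex_nonneg_Reals_iff \<chi>'_def)
    show "\<chi>' 1 = 1" using rs(3) by (simp add: \<chi>'_def state_one[OF st(1)] state_one[OF st(2)] flip: of_real_add)
  qed (simp_all add: \<chi>'_def state_add[OF st(1)] state_add[OF st(2)] state_scaleC[OF st(1)] state_scaleC[OF st(2)] algebra_simps)
  moreover have "r *\<^sub>R v + s *\<^sub>R w = (\<chi> i. \<chi>' (A $ i))"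
    by (simp add: vec_eq_iff vw \<chi>'_def complex_eq_iff)
  ultimately show "r *\<^sub>R v + s *\<^sub>R w \<in> numerical_range A"
    by (auto simp: numerical_range_def)
qed

text \<open>The state space is a closed subset of a product of discs, which is compact by Tychonoff's theorem.\<close>
lemma compact_states: "compact {\<phi> :: 'a::cstar_algebra \<Rightarrow> complex. state \<phi>}"
proof -
  let ?K = "PiE UNIV (\<lambda>a::'a. cball (0::complex) (2 * norm a))"
  have "compactin (product_topology (\<lambda>a::'a. euclidean) UNIV) ?K"
    by (subst compactin_PiE) auto
  then have K: "compact ?K" by (simp add: euclidean_product_topology)
  have cont: "continuous_on UNIV (\<lambda>\<phi> :: 'a \<Rightarrow> complex. \<phi> a)" for a
    by (rule continuous_on_product_coordinates)
  have "{\<phi> :: 'a \<Rightarrow> complex. state \<phi>} =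
      (\<Inter>a b. {\<phi>. \<phi> (a + b) = \<phi> a + \<phi> b}) \<inter> (\<Inter>c a. {\<phi>. \<phi> (c *\<^sub>C a) = c * \<phi> a})
      \<inter> (\<Inter>a. (\<lambda>\<phi>. \<phi> (a\<^sup>\<star> * a)) -` \<real>\<^sub>\<ge>\<^sub>0) \<inter> {\<phi>. \<phi> 1 = 1}"
    by (auto simp: state_def)
  moreover have "closed \<dots>"
    by (intro closed_Int closed_INT ballI closed_Collect_eq closed_vimage closed_nonneg_Reals_complex
        continuous_intros cont)
  ultimately have "closed {\<phi> :: 'a \<Rightarrow> complex. state \<phi>}" by simp
  then have "compact (?K \<inter> {\<phi>. state \<phi>})" by (rule compact_Int_closed[OF K])
  moreover have "?K \<inter> {\<phi>. state \<phi>} = {\<phi>. state \<phi>}"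
    using state_norm_le by (auto simp: PiE_def)
  ultimately show ?thesis by simp
qed

lemma closed_numerical_range: "closed (numerical_range (A :: 'a::cstar_algebra ^ 'n::finite))"
proof -
  have "numerical_range A = (\<lambda>\<phi>. \<chi> i. \<phi> (A $ i)) ` {\<phi>. state \<phi>}"
    by (auto simp: numerical_range_def)
  moreover have "continuous_on {\<phi> :: 'a \<Rightarrow> complex. state \<phi>} (\<lambda>\<phi>. \<chi> i. \<phi> (A $ i))"
    by (intro continuous_on_vec_lambda continuous_on_subset[OF continuous_on_product_coordinates]) auto
  ultimately show ?thesis
    using compact_continuous_image[OF _ compact_states] compact_imp_closed by metis
qed

section \<open>The numerical range as a polar dual\<close>

lemma numerical_range_subset_polar:
  fixes u :: "'a::cstar_algebra ^ 'n::finite"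
  assumes "cstar_probability_space \<tau>" "free_haar_unitaries \<tau> u"
  shows "numerical_range u \<subseteq> polar_dual Q_set"
proof
  fix w assume "w \<in> numerical_range u"
  then obtain \<phi> where \<phi>: "state \<phi>" and w: "w = (\<chi> i. \<phi> (u $ i))" by (auto simp: numerical_range_def)
  have "Re (\<Sum>i\<in>UNIV. \<phi> (u $ i) * z $ i) \<le> 1" if "z \<in> Q_set" for z :: "complex ^ 'n"
  proof (rule field_le_epsilon)
    fix e :: real assume "e > 0"
    then obtain t where "t > 0" "level t (\<chi> i. cmod (z $ i)) \<le> 1 + e"
      using \<open>z \<in> Q_set\<close> by (auto simp: Q_set_def E_set_iff)
    then show "Re (\<Sum>i\<in>UNIV. \<phi> (u $ i) * z $ i) \<le> 1 + e"
      using state_re_le_level[OF assms \<phi>, of t z] by simp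
  qed
  then show "w \<in> polar_dual Q_set" by (simp add: polar_dual_def w)
qed

text \<open>
  A point outside is separated by some direction \<open>z\<close> with bound \<open>\<beta>\<close>. As \<open>\<tau>\<close> vanishes on the generators,
  \<open>\<beta>\<close> is positive, and rescaling \<open>z\<close> by \<open>\<beta>\<close> gives a point of \<open>Q_set\<close> that violates the polar inequality.
\<close>
lemma polar_subset_numerical_range:
  fixes u :: "'a::cstar_algebra ^ 'n::finite"
  assumes "state \<tau>" "free_haar_unitaries \<tau> u"
  shows "polar_dual Q_set \<subseteq> numerical_range u"
proof
  fix w :: "complex ^ 'n" assume polar: "w \<in> polar_dual Q_set"
  show "w \<in> numerical_range u"
  proof (rule ccontr)
    assume "w \<notin> numerical_range u"
    then obtain a b where ab: "a \<bullet> w < b" "\<And>v. v \<in> numerical_range u \<Longrightarrow> a \<bullet> v > b"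
      using separating_hyperplane_closed_point[OF convex_numerical_range closed_numerical_range] by blast
    \<comment> \<open>The real inner product in terms of the bilinear pairing, with the sign making \<open>\<beta>\<close> an upper bound.\<close>
    define z where "z = (\<chi> i. - cnj (a $ i))"
    define \<beta> where "\<beta> = - b"
    have inner: "Re (\<Sum>i\<in>UNIV. v $ i * z $ i) = - (a \<bullet> v)" for v
      by (simp add: z_def inner_vec_def inner_complex_def sum_negf[symmetric] algebra_simps)
    have w\<beta>: "Re (\<Sum>i\<in>UNIV. w $ i * z $ i) > \<beta>" unfolding inner \<beta>_def using ab(1) by simp
    have states: "Re (\<Sum>i\<in>UNIV. \<phi> (u $ i) * z $ i) < \<beta>" if "state \<phi>" for \<phi>
    proof -
      let ?v = "\<chi> i. \<phi> (u $ i)"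
      have "?v \<in> numerical_range u" using that by (auto simp: numerical_range_def)
      then have "Re (\<Sum>i\<in>UNIV. ?v $ i * z $ i) < \<beta>" unfolding inner \<beta>_def using ab(2) by simp
      then show ?thesis by (simp only: vec_lambda_beta)
    qed
    have "\<tau> (u $ i) = 0" for i
      using free_haar_word_zero[OF assms(2), of "[(i, True)]"] by (simp add: reduced_Cons word_Cons letter_def)
    then have \<beta>: "\<beta> > 0" using states[OF assms(1)] by simp
    define x :: "real ^ 'n" where "x = (\<chi> i. cmod (z $ i))"
    have "x \<noteq> 0"
    proof
      assume "x = 0"
      then have "z $ i = 0" for i by (simp add: x_def vec_eq_iff)
      then show False using w\<beta> \<beta> by simp
    qed
    then obtain t where t: "t \<ge> 0"
        "(\<Sum>i\<in>UNIV. if x $ i = 0 then 0 else 1 - t / sqrt (t\<^sup>2 + (x $ i)\<^sup>2)) = 1"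
      by (rule critical_point_exists)
    have level: "level t x \<le> \<beta>"
      unfolding x_def
      by (rule critical_level_le_of_states[OF assms t(1)])
         (use t(2) states in \<open>auto simp: x_def less_imp_le cong: if_cong\<close>)
    define z' where "z' = (\<chi> i. z $ i / of_real \<beta>)"
    have z': "(\<chi> i. cmod (z' $ i)) = inverse \<beta> *\<^sub>R x"
      using \<beta> by (simp add: vec_eq_iff z'_def x_def norm_divide field_simps)
    have "z' \<in> Q_set"
      unfolding Q_set_def E_set_iff mem_Collect_eq z'
    proof (intro allI impI exI conjI)
      fix e :: real assume e: "e > 0"
      have t0: "inverse \<beta> * t \<ge> 0" using \<beta> t(1) by simp
      then show "inverse \<beta> * t + e > 0" using e by linarith
      have "level (inverse \<beta> * t + e) (inverse \<beta> *\<^sub>R x) \<le> level (inverse \<beta> * t) (inverse \<beta> *\<^sub>R x) + e"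
        by (rule level_add_le[OF t0]) (use e in simp)
      also have "level (inverse \<beta> * t) (inverse \<beta> *\<^sub>R x) = inverse \<beta> * level t x"
        by (rule level_scale) (use \<beta> in simp)
      also have "\<dots> \<le> 1" using \<beta> level by (simp add: field_simps)
      finally show "level (inverse \<beta> * t + e) (inverse \<beta> *\<^sub>R x) \<le> 1 + e" by simp
    qed
    then have "Re (\<Sum>i\<in>UNIV. w $ i * z' $ i) \<le> 1" using polar by (simp add: polar_dual_def)
    also have "(\<Sum>i\<in>UNIV. w $ i * z' $ i) = (\<Sum>i\<in>UNIV. w $ i * z $ i) / of_real \<beta>"
      by (simp add: z'_def sum_divide_distrib)
    finally show False using w\<beta> \<beta> by (simp only: Re_divide_of_real) (simp add: divide_le_eq)
  qed
qed

text \<open>\<open>Q_set\<close> is contained in the unit polydisc, so its polar contains a ball.\<close>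
lemma zero_in_interior_polar_Q_set: "0 \<in> interior (polar_dual (Q_set :: (complex ^ 'n::finite) set))"
proof (rule interiorI)
  let ?d = "real CARD('n)"
  show "open (ball (0 :: complex ^ 'n) (1 / ?d))" by simp
  show "0 \<in> ball (0 :: complex ^ 'n) (1 / ?d)" by simp
  show "ball 0 (1 / ?d) \<subseteq> polar_dual (Q_set :: (complex ^ 'n) set)"
  proof
    fix w :: "complex ^ 'n" assume w: "w \<in> ball 0 (1 / ?d)"
    have "Re (\<Sum>i\<in>UNIV. w $ i * z $ i) \<le> 1" if zQ: "z \<in> Q_set" for z
    proof -
      have z: "cmod (z $ i) \<le> 1" for i
      proof (rule field_le_epsilon)
        fix e :: real assume "e > 0"
        then obtain t where "t > 0" "level t (\<chi> i. cmod (z $ i)) \<le> 1 + e"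
          using zQ by (auto simp: Q_set_def E_set_iff)
        then show "cmod (z $ i) \<le> 1 + e"
          using level_ge_coordinate[of t "\<chi> i. cmod (z $ i)" i] by simp
      qed
      have "Re (\<Sum>i\<in>UNIV. w $ i * z $ i) \<le> cmod (\<Sum>i\<in>UNIV. w $ i * z $ i)" by (rule complex_Re_le_cmod)
      also have "\<dots> \<le> (\<Sum>i\<in>(UNIV :: 'n set). norm w)"
      proof (rule sum_norm_le)
        show "cmod (w $ i * z $ i) \<le> norm w" for i
          using mult_mono[OF Finite_Cartesian_Product.norm_nth_le[of w i] z[of i]] by (simp add: norm_mult)
      qed
      also have "\<dots> \<le> 1" using w by (simp add: field_simps)
      finally show ?thesis .
    qed
    then show "w \<in> polar_dual Q_set" by (simp add: polar_dual_def)
  qed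
qed

theorem proposition4p3:
  fixes \<tau> :: "'a::cstar_algebra \<Rightarrow> complex"
    and u :: "'a ^ 'n::finite"
  assumes "cstar_probability_space \<tau>"
    and "free_haar_unitaries \<tau> u"
  shows "numerical_range u = polar_dual Q_set \<and> 0 \<in> interior (numerical_range u)"
proof -
  have "state \<tau>" using assms(1) by (simp add: cstar_probability_space_def)
  then have "numerical_range u = polar_dual Q_set"
    using numerical_range_subset_polar[OF assms] polar_subset_numerical_range[OF _ assms(2)] by blast
  then show ?thesis using zero_in_interior_polar_Q_set by simp
qed

end
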